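(* Let $f\colon X\rightarrow Y$ be a continuous onto map, where $X$ is a compact Hausdorff space and $Y$ is a metric space. Then $f$ is semi-open if and only if the induced map $f_*\colon\mathcal{M}^1(X)\rightarrow\mathcal{M}^1(Y)$ is semi-open.
   Context: A continuous onto map $g\colon A\to B$ between topological spaces is called semi-open if $\mathrm{int}_B\, g[U]\neq\emptyset$ for every nonempty open set $U\subseteq A$. For a compact Hausdorff space $X$, $\mathcal{M}^1(X)$ denotes the set of all regular Borel probability measures on $X$ with the weak* topology ($\mu_\alpha\to\mu$ iff $\mu_\alpha(\varphi)\to\mu(\varphi)$ for all continuous $\varphi\colon X\to\mathbb{R}$); it is a compact Hausdorff space. For a continuous map $f\colon X\to Y$ between compact Hausdorff spaces, $f_*\colon\mathcal{M}^1(X)\to\mathcal{M}^1(Y)$ is $f_*(\mu)=\mu\circ f^{-1}$. *)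

theory Defs
  imports "HOL-Analysis.Analysis" "HOL-Probability.Probability"
begin

definition semi_open_map :: "'a topology \<Rightarrow> 'b topology \<Rightarrow> ('a \<Rightarrow> 'b) \<Rightarrow> bool" where
  "semi_open_map A B g \<longleftrightarrow>
     continuous_map A B g \<and> g ` topspace A = topspace B \<and>
     (\<forall>U. openin A U \<and> U \<noteq> {} \<longrightarrow> B interior_of (g ` U) \<noteq> {})"

definition borel_of :: "'a topology \<Rightarrow> 'a measure" where
  "borel_of X = sigma (topspace X) {U. openin X U}"

definition regular_borel_prob :: "'a topology \<Rightarrow> 'a measure \<Rightarrow> bool" where
  "regular_borel_prob X \<mu> \<longleftrightarrow>
     space \<mu> = topspace X \<and> sets \<mu> = sets (borel_of X) \<and> prob_space \<mu> \<and>
     (\<forall>B \<in> sets \<mu>.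
        emeasure \<mu> B = (INF U\<in>{U. openin X U \<and> B \<subseteq> U}. emeasure \<mu> U) \<and>
        emeasure \<mu> B = (SUP K\<in>{K. compactin X K \<and> K \<subseteq> B}. emeasure \<mu> K))"

text \<open>The weak* topology is the initial topology of the functionals \<open>\<mu> \<mapsto> \<integral>\<phi> d\<mu>\<close>;
  \<open>limitin_weak_star_prob\<close> below characterises its convergence (along arbitrary filters).\<close>

definition weak_star_prob :: "'a topology \<Rightarrow> 'a measure topology" where
  "weak_star_prob X = topology_generated_by
     {{\<mu>. regular_borel_prob X \<mu> \<and> (\<integral>x. \<phi> x \<partial>\<mu>) \<in> V} | \<phi> V.
        continuous_map X euclideanreal \<phi> \<and> open V}"

definition pushforward :: "'b topology \<Rightarrow> ('a \<Rightarrow> 'b) \<Rightarrow> 'a measure \<Rightarrow> 'b measure" where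
  "pushforward Y f \<mu> = distr \<mu> (borel_of Y) f"

lemma space_borel_of [simp]: "space (borel_of X) = topspace X"
  by (simp add: borel_of_def space_measure_of_conv)

lemma sets_borel_of: "sets (borel_of X) = sigma_sets (topspace X) {U. openin X U}"
  unfolding borel_of_def by (rule sets_measure_of) (auto dest: openin_subset)

lemma continuous_map_measurable_borel_of:
  assumes "continuous_map X Y f"
  shows "f \<in> borel_of X \<rightarrow>\<^sub>M borel_of Y"
proof (rule measurable_sigma_sets[OF sets_borel_of])
  show "{U. openin Y U} \<subseteq> Pow (topspace Y)"
    by (auto dest: openin_subset)
  show "f \<in> space (borel_of X) \<rightarrow> topspace Y"
    using assms by (auto simp: continuous_map_def)
  fix V assume "V \<in> {U. openin Y U}"
  then have "openin X {x \<in> topspace X. f x \<in> V}"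
    using assms by (auto simp: continuous_map_def)
  moreover have "f -` V \<inter> space (borel_of X) = {x \<in> topspace X. f x \<in> V}"
    by auto
  ultimately show "f -` V \<inter> space (borel_of X) \<in> sets (borel_of X)"
    by (auto simp: sets_borel_of)
qed

lemma emeasure_pushforward:
  assumes "continuous_map X Y f" "regular_borel_prob X \<mu>" "B \<in> sets (borel_of Y)"
  shows "emeasure (pushforward Y f \<mu>) B = emeasure \<mu> {x \<in> topspace X. f x \<in> B}"
proof -
  have "f \<in> \<mu> \<rightarrow>\<^sub>M borel_of Y"
    using continuous_map_measurable_borel_of[OF assms(1)] assms(2)
    by (simp add: regular_borel_prob_def cong: measurable_cong_sets)
  moreover have "f -` B \<inter> space \<mu> = {x \<in> topspace X. f x \<in> B}"
    using assms(2) by (auto simp: regular_borel_prob_def)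
  ultimately show ?thesis
    using assms(3) by (simp add: pushforward_def emeasure_distr)
qed

lemma topspace_weak_star_prob [simp]:
  "topspace (weak_star_prob X) = {\<mu>. regular_borel_prob X \<mu>}"
proof -
  have "{\<mu>. regular_borel_prob X \<mu>} = {\<mu>. regular_borel_prob X \<mu> \<and> (\<integral>x. 0 \<partial>\<mu>) \<in> (UNIV::real set)}"
    by simp
  moreover have "continuous_map X euclideanreal (\<lambda>x. 0)" "open (UNIV::real set)"
    by auto
  ultimately show ?thesis
    unfolding weak_star_prob_def topology_generated_by_topspace by blast
qed

lemma limitin_weak_star_prob:
  assumes "eventually (\<lambda>i. regular_borel_prob X (m i)) F"
  shows "limitin (weak_star_prob X) m \<mu> F \<longleftrightarrow>
    regular_borel_prob X \<mu> \<and>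
    (\<forall>\<phi>. continuous_map X euclideanreal \<phi> \<longrightarrow> ((\<lambda>i. \<integral>x. \<phi> x \<partial>m i) \<longlongrightarrow> (\<integral>x. \<phi> x \<partial>\<mu>)) F)"
    (is "?L \<longleftrightarrow> ?R")
proof
  assume L: ?L
  show ?R
  proof (intro conjI allI impI)
    show mu: "regular_borel_prob X \<mu>"
      using limitin_topspace[OF L] by simp
    fix \<phi> assume \<phi>: "continuous_map X euclideanreal \<phi>"
    show "((\<lambda>i. \<integral>x. \<phi> x \<partial>m i) \<longlongrightarrow> (\<integral>x. \<phi> x \<partial>\<mu>)) F"
    proof (rule topological_tendstoI)
      fix V :: "real set" assume V: "open V" "(\<integral>x. \<phi> x \<partial>\<mu>) \<in> V"
      have "openin (weak_star_prob X) {\<mu>. regular_borel_prob X \<mu> \<and> (\<integral>x. \<phi> x \<partial>\<mu>) \<in> V}"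
        unfolding weak_star_prob_def using \<phi> V by (intro topology_generated_by_Basis) blast
      from limitinD[OF L this] show "eventually (\<lambda>i. (\<integral>x. \<phi> x \<partial>m i) \<in> V) F"
        using mu V by (auto elim: eventually_mono)
    qed
  qed
next
  assume R: ?R
  have "eventually (\<lambda>i. m i \<in> U) F" if "openin (weak_star_prob X) U" "\<mu> \<in> U" for U
  proof -
    from that(1) have "generate_topology_on
        {{\<mu>. regular_borel_prob X \<mu> \<and> (\<integral>x. \<phi> x \<partial>\<mu>) \<in> V} | \<phi> V.
          continuous_map X euclideanreal \<phi> \<and> open V} U"
      unfolding weak_star_prob_def by (rule openin_topology_generated_by)
    then show ?thesis using that(2)
    proof induction
      case (UN K)
      then obtain k where "k \<in> K" "\<mu> \<in> k" by auto
      with UN.IH have "eventually (\<lambda>i. m i \<in> k) F" by blast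
      with \<open>k \<in> K\<close> show ?case by (auto elim: eventually_mono)
    next
      case (Basis S)
      then obtain \<phi> V where S: "S = {\<mu>. regular_borel_prob X \<mu> \<and> (\<integral>x. \<phi> x \<partial>\<mu>) \<in> V}"
        "continuous_map X euclideanreal \<phi>" "open V" by auto
      with Basis R have "eventually (\<lambda>i. (\<integral>x. \<phi> x \<partial>m i) \<in> V) F"
        by (auto dest: topological_tendstoD)
      with assms show ?case
        unfolding S(1) by eventually_elim auto
    qed (auto simp: eventually_conj_iff)
  qed
  with R show ?L by (auto simp: limitin_def)
qed

end

theory Submission
  imports Defs
begin

text \<open>
  The proof rests on two facts about regular probability measures on compact Hausdorff spaces.

  First, every weak* neighbourhood of a measure admits finitely many points with weights such that it
  contains all measures having almost the prescribed mass on suitable disjoint open neighbourhoods of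
  these points (\<open>weak_star_prob_nbhd_masses\<close>). In particular finitely supported measures are dense, even
  with supports in a given dense set. If \<open>f ` U\<close> had empty interior, then for a closed neighbourhood
  \<open>C \<subseteq> U\<close> of a point the measures on \<open>Y\<close> vanishing on \<open>f ` C\<close> would be dense, while semi-openness of
  the induced map yields a nonempty open set of images of measures charging \<open>C\<close>, and these charge
  \<open>f ` C\<close> (\<open>semi_open_map_if_pushforward\<close>).

  Second, measures can be lifted along \<open>f\<close> with control over where their mass goes
  (\<open>ex_lift_with_mass\<close>): if disjoint open sets of \<open>Y\<close> are covered by the images of closed sets of \<open>X\<close>,
  the mass of each open set can be distributed in given proportions over the closed sets lying above it.
  When \<open>f\<close> is semi-open, the small neighbourhoods of the points describing an open set of measures on \<open>X\<close>
  have images with interior points, and every measure on \<open>Y\<close> with suitable masses near these interior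
  points lifts into that open set (\<open>semi_open_map_pushforward\<close>).

  A lift would be easy to write down if \<open>f\<close> had measurable sections, which it need not have. Therefore
  a measure \<open>\<nu>\<close> on \<open>Y\<close> is first extended to a finitely additive function on all subsets of \<open>Y\<close>, by compactness of a
  product of intervals (\<open>prob_space_finitely_additive_extension\<close>), and then transported to \<open>X\<close> along
  arbitrary sections. A finitely additive function on the subsets of \<open>X\<close> is dominated on closed sets by
  a regular Borel probability measure, obtained from it as from a content
  (\<open>ex_regular_ge_finitely_additive\<close>); domination on closed sets suffices both for identifying
  the image with \<open>\<nu>\<close> and for the lower bounds on masses (\<open>ex_lift_of_finitely_additive\<close>).
\<close>

section \<open>Regular Borel probability measures on compact spaces\<close>

lemma openin_borel_of: "openin X U \<Longrightarrow> U \<in> sets (borel_of X)"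
  by (auto simp: sets_borel_of)

lemma closedin_borel_of:
  assumes "closedin X C"
  shows "C \<in> sets (borel_of X)"
proof -
  have "topspace X - C \<in> sets (borel_of X)"
    using assms by (intro openin_borel_of) auto
  then have "space (borel_of X) - (topspace X - C) \<in> sets (borel_of X)"
    by (rule sets.compl_sets)
  moreover have "space (borel_of X) - (topspace X - C) = C"
    using closedin_subset[OF assms] by auto
  ultimately show ?thesis by simp
qed

lemma regular_borel_probD:
  assumes "regular_borel_prob X \<mu>"
  shows "prob_space \<mu>" "space \<mu> = topspace X" "sets \<mu> = sets (borel_of X)"
  using assms by (auto simp: regular_borel_prob_def)

lemma regular_borel_prob_sets:
  assumes "regular_borel_prob X \<mu>"
  shows "openin X U \<Longrightarrow> U \<in> sets \<mu>" "closedin X C \<Longrightarrow> C \<in> sets \<mu>"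
  using assms by (simp_all add: regular_borel_probD openin_borel_of closedin_borel_of)

text \<open>Measures are compared below as real numbers, with an error \<open>e\<close>, rather than through infima in
  the extended reals.\<close>

lemma regular_borel_prob_outer:
  assumes "regular_borel_prob X \<mu>" "B \<in> sets \<mu>" "0 < (e::real)"
  obtains U where "openin X U" "B \<subseteq> U" "measure \<mu> U < measure \<mu> B + e"
proof -
  interpret prob_space \<mu> by (rule regular_borel_probD(1)[OF assms(1)])
  have "(INF U\<in>{U. openin X U \<and> B \<subseteq> U}. emeasure \<mu> U) = emeasure \<mu> B"
    using assms by (auto simp: regular_borel_prob_def)
  also have "\<dots> < ennreal (measure \<mu> B + e)"
    using assms(3) by (auto simp: emeasure_eq_measure intro!: ennreal_lessI)
  finally obtain U where "openin X U" "B \<subseteq> U" "emeasure \<mu> U < ennreal (measure \<mu> B + e)"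
    by (auto simp: INF_less_iff)
  then show ?thesis
    using that by (auto simp: emeasure_eq_measure ennreal_less_iff)
qed

text \<open>In a compact space closed sets are compact, so inner regularity of a set is outer regularity
  of its complement.\<close>

lemma regular_borel_probI:
  assumes "compact_space X" and sp: "space \<mu> = topspace X" and se: "sets \<mu> = sets (borel_of X)"
    and pr: "prob_space \<mu>"
    and outer: "\<And>B e. B \<in> sets \<mu> \<Longrightarrow> 0 < (e::real) \<Longrightarrow>
      \<exists>U. openin X U \<and> B \<subseteq> U \<and> measure \<mu> U < measure \<mu> B + e"
  shows "regular_borel_prob X \<mu>"
  unfolding regular_borel_prob_def
proof (intro conjI ballI sp se pr)
  interpret prob_space \<mu> by fact
  fix B assume B: "B \<in> sets \<mu>"
  show "emeasure \<mu> B = (INF U\<in>{U. openin X U \<and> B \<subseteq> U}. emeasure \<mu> U)"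
  proof (rule antisym)
    show "emeasure \<mu> B \<le> (INF U\<in>{U. openin X U \<and> B \<subseteq> U}. emeasure \<mu> U)"
      by (auto intro!: INF_greatest emeasure_mono simp: se openin_borel_of)
    show "(INF U\<in>{U. openin X U \<and> B \<subseteq> U}. emeasure \<mu> U) \<le> emeasure \<mu> B"
    proof (rule ennreal_le_epsilon)
      fix e :: real assume "0 < e"
      from outer[OF B this] obtain U where U: "openin X U" "B \<subseteq> U" "measure \<mu> U < measure \<mu> B + e"
        by auto
      have "(INF U\<in>{U. openin X U \<and> B \<subseteq> U}. emeasure \<mu> U) \<le> emeasure \<mu> U"
        using U by (intro INF_lower) auto
      also have "\<dots> \<le> emeasure \<mu> B + ennreal e"
        using U \<open>0 < e\<close> by (simp add: emeasure_eq_measure flip: ennreal_plus)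
      finally show "(INF U\<in>{U. openin X U \<and> B \<subseteq> U}. emeasure \<mu> U) \<le> emeasure \<mu> B + ennreal e" .
    qed
  qed
  show "emeasure \<mu> B = (SUP K\<in>{K. compactin X K \<and> K \<subseteq> B}. emeasure \<mu> K)"
  proof (rule antisym)
    show "(SUP K\<in>{K. compactin X K \<and> K \<subseteq> B}. emeasure \<mu> K) \<le> emeasure \<mu> B"
      using B by (auto intro!: SUP_least emeasure_mono)
    show "emeasure \<mu> B \<le> (SUP K\<in>{K. compactin X K \<and> K \<subseteq> B}. emeasure \<mu> K)"
    proof (rule ennreal_le_epsilon)
      fix e :: real assume "0 < e"
      from outer[OF sets.compl_sets[OF B] this] obtain U
        where U: "openin X U" "space \<mu> - B \<subseteq> U" "measure \<mu> U < measure \<mu> (space \<mu> - B) + e"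
        by auto
      have Us: "U \<in> sets \<mu>" using U(1) by (simp add: se openin_borel_of)
      have K: "compactin X (topspace X - U)" "topspace X - U \<subseteq> B"
        using U(1,2) assms(1) by (auto intro!: closedin_compact_space simp: sp)
      have "measure \<mu> B \<le> measure \<mu> (topspace X - U) + e"
        using U(3) B prob_compl[OF B] prob_compl[OF Us] by (simp add: sp)
      then have "emeasure \<mu> B \<le> emeasure \<mu> (topspace X - U) + ennreal e"
        using \<open>0 < e\<close> by (simp add: emeasure_eq_measure flip: ennreal_plus)
      also have "\<dots> \<le> (SUP K\<in>{K. compactin X K \<and> K \<subseteq> B}. emeasure \<mu> K) + ennreal e"
        using K by (intro add_right_mono SUP_upper) auto
      finally show "emeasure \<mu> B \<le> (SUP K\<in>{K. compactin X K \<and> K \<subseteq> B}. emeasure \<mu> K) + ennreal e" .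
    qed
  qed
qed

section \<open>From finitely additive set functions to regular measures\<close>

definition finitely_additive :: "('a set \<Rightarrow> real) \<Rightarrow> bool" where
  "finitely_additive m \<longleftrightarrow>
     (\<forall>A. 0 \<le> m A) \<and> (\<forall>A B. A \<inter> B = {} \<longrightarrow> m (A \<union> B) = m A + m B)"

lemma finitely_additive_nonneg: "finitely_additive m \<Longrightarrow> 0 \<le> m A"
  by (simp add: finitely_additive_def)

lemma finitely_additive_Un_disjoint:
  "finitely_additive m \<Longrightarrow> A \<inter> B = {} \<Longrightarrow> m (A \<union> B) = m A + m B"
  by (simp add: finitely_additive_def)

lemma finitely_additive_empty: "finitely_additive m \<Longrightarrow> m {} = 0"
  using finitely_additive_Un_disjoint[of m "{}" "{}"] by simp

lemma finitely_additive_mono: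
  assumes "finitely_additive m" "A \<subseteq> B"
  shows "m A \<le> m B"
proof -
  have "m (A \<union> (B - A)) = m A + m (B - A)"
    using assms by (intro finitely_additive_Un_disjoint) auto
  moreover have "A \<union> (B - A) = B" using assms by auto
  ultimately show ?thesis using finitely_additive_nonneg[OF assms(1), of "B - A"] by simp
qed

lemma finitely_additive_Un_le:
  assumes "finitely_additive m"
  shows "m (A \<union> B) \<le> m A + m B"
proof -
  have "m (A \<union> (B - A)) = m A + m (B - A)"
    using assms by (intro finitely_additive_Un_disjoint) auto
  moreover have "m (B - A) \<le> m B" using assms by (intro finitely_additive_mono) auto
  ultimately show ?thesis by simp
qed

lemma finitely_additive_UN:
  assumes "finitely_additive m" "finite I" "disjoint_family_on A I"
  shows "m (\<Union>i\<in>I. A i) = (\<Sum>i\<in>I. m (A i))"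
  using assms(2,3)
proof (induction I)
  case (insert i I)
  have "m (A i \<union> (\<Union>i\<in>I. A i)) = m (A i) + m (\<Union>i\<in>I. A i)"
    using insert.prems insert.hyps
    by (intro finitely_additive_Un_disjoint[OF assms(1)]) (auto simp: disjoint_family_on_def)
  then show ?case
    using insert by (simp add: disjoint_family_on_def)
qed (simp add: finitely_additive_empty[OF assms(1)])

text \<open>The classical passage from a content to a regular measure: the values on closed sets are
  approximated from inside on open sets and then from outside on all sets.\<close>

definition inner_content :: "'a topology \<Rightarrow> ('a set \<Rightarrow> real) \<Rightarrow> 'a set \<Rightarrow> ennreal" where
  "inner_content X m U = (SUP K\<in>{K. closedin X K \<and> K \<subseteq> U}. ennreal (m K))"

definition outer_content :: "'a topology \<Rightarrow> ('a set \<Rightarrow> real) \<Rightarrow> 'a set \<Rightarrow> ennreal" where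
  "outer_content X m A = (INF U\<in>{U. openin X U \<and> A \<subseteq> U}. inner_content X m U)"

lemma inner_content_upper: "closedin X K \<Longrightarrow> K \<subseteq> U \<Longrightarrow> ennreal (m K) \<le> inner_content X m U"
  unfolding inner_content_def by (rule SUP_upper) auto

lemma inner_content_mono: "U \<subseteq> V \<Longrightarrow> inner_content X m U \<le> inner_content X m V"
  unfolding inner_content_def by (rule SUP_subset_mono) auto

lemma outer_content_lower: "openin X U \<Longrightarrow> A \<subseteq> U \<Longrightarrow> outer_content X m A \<le> inner_content X m U"
  unfolding outer_content_def by (rule INF_lower) auto

lemma outer_content_mono: "A \<subseteq> B \<Longrightarrow> outer_content X m A \<le> outer_content X m B"
  unfolding outer_content_def by (rule INF_superset_mono) auto

lemma outer_content_open: "openin X U \<Longrightarrow> outer_content X m U = inner_content X m U"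
  by (rule antisym)
    (auto simp: outer_content_def intro!: INF_greatest inner_content_mono INF_lower)

context
  fixes X :: "'a topology" and m :: "'a set \<Rightarrow> real"
  assumes compact: "compact_space X" and Hausdorff: "Hausdorff_space X"
    and fin_add: "finitely_additive m"
begin

lemma closed_content_le_outer_content:
  "closedin X K \<Longrightarrow> ennreal (m K) \<le> outer_content X m K"
  unfolding outer_content_def by (auto intro!: INF_greatest inner_content_upper)

lemma inner_content_approx:
  assumes "0 < e"
  obtains K where "closedin X K" "K \<subseteq> U" "inner_content X m U \<le> ennreal (m K) + ennreal e"
proof -
  have "inner_content X m U \<le> ennreal (m UNIV)"
    unfolding inner_content_def
    by (auto intro!: SUP_least ennreal_leI finitely_additive_mono[OF fin_add])
  then have fin: "inner_content X m U \<noteq> \<infinity>"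
    by (auto simp: top_unique)
  show ?thesis
  proof (cases "inner_content X m U = 0")
    case True
    then show ?thesis using that[of "{}"] by auto
  next
    case False
    then have "inner_content X m U - ennreal e < inner_content X m U"
      using fin assms by (intro ennreal_between) (auto simp: zero_less_iff_neq_zero less_top[symmetric])
    then obtain K where K: "closedin X K" "K \<subseteq> U" "inner_content X m U - ennreal e < ennreal (m K)"
      by (auto simp: inner_content_def less_SUP_iff)
    then have "inner_content X m U \<le> ennreal (m K) + ennreal e"
      using less_imp_le[OF K(3)] by (simp add: ennreal_minus_le_iff add.commute)
    with K that show ?thesis by blast
  qed
qed

text \<open>Normality splits a closed subset of a union of two open sets into closed subsets of each, so that
  subadditivity on closed sets passes to the values on open sets.\<close>

lemma closed_content_le_sum_inner_content:
  assumes "finite I" "\<And>i. i \<in> I \<Longrightarrow> openin X (U i)" "closedin X K" "K \<subseteq> (\<Union>i\<in>I. U i)"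
  shows "ennreal (m K) \<le> (\<Sum>i\<in>I. inner_content X m (U i))"
  using assms
proof (induction I arbitrary: K)
  case empty
  then show ?case by (simp add: finitely_additive_empty[OF fin_add])
next
  case (insert j I)
  let ?V = "\<Union>i\<in>I. U i"
  have "normal_space X"
    using compact Hausdorff by (simp add: compact_Hausdorff_or_regular_imp_normal_space)
  moreover have "closedin X (K - ?V)" "closedin X (K - U j)" "disjnt (K - ?V) (K - U j)"
    using insert.prems by (auto intro!: closedin_diff simp: disjnt_def)
  ultimately obtain A B where AB: "openin X A" "openin X B" "K - ?V \<subseteq> A" "K - U j \<subseteq> B" "disjnt A B"
    unfolding normal_space_def by metis
  \<comment> \<open>\<open>K - B\<close> avoids \<open>K - U j\<close> and \<open>K - A\<close> avoids \<open>K - ?V\<close>.\<close>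
  have K1: "closedin X (K - B)" "K - B \<subseteq> U j" and K2: "closedin X (K - A)" "K - A \<subseteq> ?V"
    using AB insert.prems by (auto intro!: closedin_diff)
  have "(K - B) \<union> (K - A) = K" using AB by (auto simp: disjnt_def)
  then have "m K \<le> m (K - B) + m (K - A)"
    using finitely_additive_Un_le[OF fin_add, of "K - B" "K - A"] by simp
  then have "ennreal (m K) \<le> ennreal (m (K - B)) + ennreal (m (K - A))"
    by (simp add: finitely_additive_nonneg[OF fin_add] flip: ennreal_plus)
  also have "\<dots> \<le> inner_content X m (U j) + (\<Sum>i\<in>I. inner_content X m (U i))"
    using K1 K2 insert by (intro add_mono inner_content_upper insert.IH) auto
  finally show ?case using insert by simp
qed

text \<open>A closed subset of a countable union of open sets is compact, hence inside a finite subunion; this is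
  where countable subadditivity comes from although \<open>m\<close> is only finitely additive.\<close>

lemma outer_content_UN_open:
  fixes U :: "nat \<Rightarrow> 'a set"
  assumes "\<And>i. openin X (U i)"
  shows "outer_content X m (\<Union>i. U i) \<le> (\<Sum>i. inner_content X m (U i))"
proof -
  have op: "openin X (\<Union>i. U i)" using assms by auto
  show ?thesis
    unfolding outer_content_open[OF op] unfolding inner_content_def[of _ _ "\<Union>i. U i"]
  proof (rule SUP_least, clarsimp)
    fix K assume K: "closedin X K" "K \<subseteq> (\<Union>i. U i)"
    have "compactin X K" using compact K by (simp add: closedin_compact_space)
    moreover have "\<forall>V\<in>range U. openin X V" "K \<subseteq> \<Union>(range U)" using K assms by auto
    ultimately obtain \<F> where \<F>: "finite \<F>" "\<F> \<subseteq> range U" "K \<subseteq> \<Union>\<F>"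
      unfolding compactin_def by meson
    then obtain J where "finite J" "\<F> = U ` J"
      using finite_subset_image[of \<F> U UNIV] by auto
    with \<F> have J: "finite J" "K \<subseteq> (\<Union>i\<in>J. U i)" by auto
    have "ennreal (m K) \<le> (\<Sum>i\<in>J. inner_content X m (U i))"
      using closed_content_le_sum_inner_content[of J U K] J K assms by auto
    also have "\<dots> \<le> (\<Sum>i. inner_content X m (U i))"
      using J by (intro sum_le_suminf) auto
    finally show "ennreal (m K) \<le> (\<Sum>i. inner_content X m (U i))" .
  qed
qed

lemma outer_measure_space_outer_content:
  "outer_measure_space (Pow (topspace X)) (outer_content X m)"
  unfolding outer_measure_space_def
proof (intro conjI)
  show "positive (Pow (topspace X)) (outer_content X m)"
    using finitely_additive_empty[OF fin_add]
    by (simp add: positive_def outer_content_open inner_content_def cong: conj_cong)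
  show "increasing (Pow (topspace X)) (outer_content X m)"
    by (auto simp: increasing_def intro: outer_content_mono)
  show "countably_subadditive (Pow (topspace X)) (outer_content X m)"
    unfolding countably_subadditive_def
  proof (intro allI impI)
    fix A :: "nat \<Rightarrow> 'a set"
    assume "range A \<subseteq> Pow (topspace X)"
    show "outer_content X m (\<Union>i. A i) \<le> (\<Sum>i. outer_content X m (A i))"
    proof (rule ennreal_le_epsilon)
      fix e :: real assume e: "0 < e" "(\<Sum>n. outer_content X m (A n)) < top"
      then have "outer_content X m (A n) < outer_content X m (A n) + e * (1/2)^Suc n" for n
        by (auto simp add: less_top dest!: ennreal_suminf_lessD)
      then have "\<exists>U. openin X U \<and> A n \<subseteq> U \<and>
          inner_content X m U < outer_content X m (A n) + e * (1/2)^Suc n" for n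
        unfolding outer_content_def INF_less_iff by auto
      then obtain U where U: "\<And>n. openin X (U n)" "\<And>n. A n \<subseteq> U n"
          "\<And>n. inner_content X m (U n) < outer_content X m (A n) + e * (1/2)^Suc n"
        by metis
      have "outer_content X m (\<Union>i. A i) \<le> outer_content X m (\<Union>i. U i)"
        using U(2) by (intro outer_content_mono) auto
      also have "\<dots> \<le> (\<Sum>n. inner_content X m (U n))"
        by (rule outer_content_UN_open[OF U(1)])
      also have "\<dots> \<le> (\<Sum>n. outer_content X m (A n) + e * (1/2) ^ Suc n)"
        using U(3) by (intro suminf_le allI less_imp_le) auto
      also have "\<dots> = (\<Sum>n. outer_content X m (A n)) + (\<Sum>n. ennreal e * ennreal ((1/2) ^ Suc n))"
        using \<open>0 < e\<close> by (subst suminf_add[symmetric])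
          (auto simp del: ennreal_suminf_cmult simp add: ennreal_mult[symmetric])
      also have "\<dots> = (\<Sum>n. outer_content X m (A n)) + e"
        unfolding ennreal_suminf_cmult
        by (subst suminf_ennreal_eq[OF zero_le_power power_half_series]) auto
      finally show "outer_content X m (\<Union>i. A i) \<le> (\<Sum>n. outer_content X m (A n)) + e" .
    qed
  qed
qed

text \<open>Given an open set \<open>V\<close> around \<open>A\<close>, a closed \<open>K \<subseteq> V \<inter> U\<close> nearly exhausting \<open>V \<inter> U\<close> and a
  closed \<open>L \<subseteq> V - K\<close> nearly exhausting \<open>V - K\<close> are disjoint subsets of \<open>V\<close>, and \<open>V - K\<close> covers
  \<open>A - U\<close>.\<close>

lemma outer_content_split_open:
  assumes U: "openin X U"
  shows "outer_content X m (A \<inter> U) + outer_content X m (A - U) \<le> outer_content X m A"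
  unfolding outer_content_def[of X m A]
proof (rule INF_greatest, clarsimp)
  fix V assume V: "openin X V" "A \<subseteq> V"
  show "outer_content X m (A \<inter> U) + outer_content X m (A - U) \<le> inner_content X m V"
  proof (rule ennreal_le_epsilon)
    fix e :: real assume "0 < e"
    then have e2: "0 < e / 2" by simp
    obtain K where K: "closedin X K" "K \<subseteq> V \<inter> U"
        "inner_content X m (V \<inter> U) \<le> ennreal (m K) + ennreal (e / 2)"
      using inner_content_approx[OF e2] by blast
    obtain L where L: "closedin X L" "L \<subseteq> V - K"
        "inner_content X m (V - K) \<le> ennreal (m L) + ennreal (e / 2)"
      using inner_content_approx[OF e2] by blast
    have "outer_content X m (A \<inter> U) \<le> inner_content X m (V \<inter> U)"
      using U V by (intro outer_content_lower) auto
    moreover have "outer_content X m (A - U) \<le> inner_content X m (V - K)"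
      using K V by (intro outer_content_lower openin_diff) auto
    ultimately have "outer_content X m (A \<inter> U) + outer_content X m (A - U)
        \<le> (ennreal (m K) + ennreal (e / 2)) + (ennreal (m L) + ennreal (e / 2))"
      using K(3) L(3) by (meson add_mono order_trans)
    also have "\<dots> = ennreal (m K + m L) + ennreal e"
      using \<open>0 < e\<close> finitely_additive_nonneg[OF fin_add]
      by (simp add: algebra_simps flip: ennreal_plus)
    also have "m K + m L = m (K \<union> L)"
      using L(2) by (intro finitely_additive_Un_disjoint[OF fin_add, symmetric]) auto
    also have "ennreal (m (K \<union> L)) \<le> inner_content X m V"
      using K L by (intro inner_content_upper closedin_Un) auto
    finally show "outer_content X m (A \<inter> U) + outer_content X m (A - U)
        \<le> inner_content X m V + ennreal e" by simp
  qed
qed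

text \<open>Open sets are measurable in the sense of Caratheodory for the outer content, whose restriction to
  Borel sets is therefore a measure; it is outer regular by construction. Every open set around a
  closed \<open>K\<close> has inner content at least \<open>m K\<close>, so the values on closed sets can only increase.\<close>

lemma ex_regular_ge_finitely_additive:
  assumes total: "m (topspace X) = 1"
  shows "\<exists>\<mu>. regular_borel_prob X \<mu> \<and> (\<forall>K. closedin X K \<longrightarrow> m K \<le> measure \<mu> K)"
proof -
  let ?\<Omega> = "topspace X" and ?f = "outer_content X m"
  let ?L = "lambda_system ?\<Omega> (Pow ?\<Omega>) ?f"
  interpret P: sigma_algebra ?\<Omega> "Pow ?\<Omega>" by (rule sigma_algebra_Pow)
  have ms: "measure_space ?\<Omega> ?L ?f"
    by (rule P.caratheodory_lemma[OF outer_measure_space_outer_content])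
  have subadd: "subadditive (Pow ?\<Omega>) ?f"
    using outer_measure_space_outer_content
    by (auto simp: outer_measure_space_def intro: P.countably_subadditive_subadditive)
  have "{U. openin X U} \<subseteq> ?L"
  proof clarsimp
    fix U assume U: "openin X U"
    have "?f (A \<inter> U) + ?f (A - U) = ?f A" if "A \<subseteq> ?\<Omega>" for A
    proof (rule antisym[OF outer_content_split_open[OF U]])
      have "?f ((A \<inter> U) \<union> (A - U)) \<le> ?f (A \<inter> U) + ?f (A - U)"
        using that by (intro subadditiveD[OF subadd]) auto
      moreover have "(A \<inter> U) \<union> (A - U) = A" by auto
      ultimately show "?f A \<le> ?f (A \<inter> U) + ?f (A - U)" by simp
    qed
    then show "U \<in> ?L"
      using openin_subset[OF U] by (auto simp: P.lambda_system_eq)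
  qed
  then have sub: "sets (borel_of X) \<subseteq> ?L"
    using ms by (auto simp: sets_borel_of measure_space_def
        dest: sigma_algebra.sigma_sets_subset)
  define \<mu> where "\<mu> = measure_of ?\<Omega> (sets (borel_of X)) ?f"
  have salg: "sigma_algebra ?\<Omega> (sets (borel_of X))"
    by (metis sets.sigma_algebra_axioms space_borel_of)
  have sets: "sets \<mu> = sets (borel_of X)" and sp: "space \<mu> = ?\<Omega>"
    using sigma_algebra.sets_measure_of_eq[OF salg] sigma_algebra.space_measure_of_eq[OF salg]
    by (auto simp: \<mu>_def)
  have em: "emeasure \<mu> A = ?f A" if "A \<in> sets (borel_of X)" for A
    unfolding \<mu>_def
  proof (rule emeasure_measure_of_sigma[OF salg _ _ that])
    show "positive (sets (borel_of X)) ?f"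
      using ms by (auto simp: measure_space_def positive_def)
    show "countably_additive (sets (borel_of X)) ?f"
      using ms sub unfolding measure_space_def countably_additive_def by blast
  qed
  have "inner_content X m ?\<Omega> = 1"
  proof (rule antisym)
    show "inner_content X m ?\<Omega> \<le> 1"
      unfolding inner_content_def using finitely_additive_mono[OF fin_add] total
      by (auto intro!: SUP_least) (metis ennreal_1 ennreal_leI)
    show "1 \<le> inner_content X m ?\<Omega>"
      using inner_content_upper[of X ?\<Omega> ?\<Omega> m] total by simp
  qed
  then have "emeasure \<mu> (space \<mu>) = 1"
    by (simp add: sp em openin_borel_of outer_content_open)
  then interpret prob_space \<mu> by (rule prob_spaceI)
  have "regular_borel_prob X \<mu>"
  proof (rule regular_borel_probI[OF compact sp sets prob_space_axioms])
    fix B and e :: real assume B: "B \<in> sets \<mu>" and "0 < e"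
    then have "?f B < ennreal (measure \<mu> B + e)"
      using em[of B] sets by (auto simp: emeasure_eq_measure intro!: ennreal_lessI)
    then obtain U where U: "openin X U" "B \<subseteq> U" "inner_content X m U < ennreal (measure \<mu> B + e)"
      unfolding outer_content_def by (auto simp: INF_less_iff)
    then have "ennreal (measure \<mu> U) < ennreal (measure \<mu> B + e)"
      using em[of U] by (simp add: openin_borel_of outer_content_open emeasure_eq_measure)
    then show "\<exists>U. openin X U \<and> B \<subseteq> U \<and> measure \<mu> U < measure \<mu> B + e"
      using U by (auto simp: ennreal_less_iff)
  qed
  moreover have "m K \<le> measure \<mu> K" if "closedin X K" for K
    using closed_content_le_outer_content[OF that] em[OF closedin_borel_of[OF that]]
    by (simp add: emeasure_eq_measure flip: ennreal_le_iff)
  ultimately show ?thesis by blast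
qed

end

section \<open>Finitely additive extensions\<close>

text \<open>Picking one point from each atom of the finite algebra generated by \<open>\<B>\<close> replaces the space by finitely
  many points without changing membership in the sets of \<open>\<B>\<close>.\<close>

lemma finite_representatives:
  assumes "finite \<B>" "\<B> \<subseteq> sets M"
  obtains r where "r \<in> space M \<rightarrow> space M" "finite (r ` space M)"
    "\<And>x B. x \<in> space M \<Longrightarrow> B \<in> \<B> \<Longrightarrow> r x \<in> B \<longleftrightarrow> x \<in> B"
    "\<And>A. r -` A \<inter> space M \<in> sets M"
proof -
  define sig where "sig x = {B \<in> \<B>. x \<in> B}" for x
  define rep where "rep t = (SOME x. x \<in> space M \<and> sig x = t)" for t
  have rep: "rep (sig x) \<in> space M \<and> sig (rep (sig x)) = sig x" if "x \<in> space M" for x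
    unfolding rep_def using someI[of "\<lambda>y. y \<in> space M \<and> sig y = sig x" x] that by simp
  have fin: "finite (sig ` space M)"
    by (rule finite_subset[of _ "Pow \<B>"]) (auto simp: sig_def assms)
  have class_sets: "{x \<in> space M. sig x = t} \<in> sets M" if "t \<subseteq> \<B>" for t
  proof -
    have "{x \<in> space M. sig x = t} = {x \<in> space M. \<forall>B\<in>\<B>. (x \<in> B) = (B \<in> t)}"
      using that by (auto simp: sig_def)
    also have "\<dots> \<in> sets M"
    proof (rule sets.sets_Collect_finite_All[OF _ assms(1)])
      fix B assume "B \<in> \<B>"
      then have "B \<in> sets M" using assms by auto
      then have "B \<inter> space M \<in> sets M" "space M - B \<in> sets M" by auto
      moreover have "{x \<in> space M. (x \<in> B) = (B \<in> t)} = (if B \<in> t then B \<inter> space M else space M - B)"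
        by auto
      ultimately show "{x \<in> space M. (x \<in> B) = (B \<in> t)} \<in> sets M" by simp
    qed
    finally show ?thesis .
  qed
  show ?thesis
  proof (rule that[of "rep \<circ> sig"])
    show "rep \<circ> sig \<in> space M \<rightarrow> space M" using rep by auto
    show "finite ((rep \<circ> sig) ` space M)" using finite_imageI[OF fin, of rep] by (simp add: image_image)
    show "(rep \<circ> sig) x \<in> B \<longleftrightarrow> x \<in> B" if "x \<in> space M" "B \<in> \<B>" for x B
      using rep[OF that(1)] that(2) by (auto simp: sig_def)
    show "(rep \<circ> sig) -` A \<inter> space M \<in> sets M" for A
    proof -
      have "(rep \<circ> sig) -` A \<inter> space M =
          (\<Union>t\<in>{t \<in> sig ` space M. rep t \<in> A}. {x \<in> space M. sig x = t})"
        by auto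
      also have "\<dots> \<in> sets M"
        using fin by (intro sets.finite_UN class_sets) (auto simp: sig_def)
      finally show ?thesis .
    qed
  qed
qed

text \<open>The finitely additive set functions with values in \<open>[0, 1]\<close> form a closed, hence compact, part of a
  product of intervals. Agreement with \<open>\<nu>\<close> on finitely many measurable sets can be achieved, by pushing
  \<open>\<nu>\<close> onto representatives of their atoms, so agreement on all of them can be achieved as well.\<close>

lemma prob_space_finitely_additive_extension:
  fixes \<nu> :: "'b measure"
  assumes "prob_space \<nu>"
  shows "\<exists>n. finitely_additive n \<and> (\<forall>B\<in>sets \<nu>. n B = measure \<nu> B)"
proof -
  interpret prob_space \<nu> by fact
  define S where "S = PiE (UNIV :: 'b set set) (\<lambda>_. {0..1::real})"
  define Add where "Add = (\<Inter>(A, B)\<in>{(A, B). A \<inter> B = {}}. {n :: 'b set \<Rightarrow> real. n (A \<union> B) = n A + n B})"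
  define Ext where "Ext B = {n :: 'b set \<Rightarrow> real. n B = measure \<nu> B}" for B
  have "compactin (product_topology (\<lambda>_. euclideanreal) UNIV) S"
    unfolding S_def by (subst compactin_PiE) auto
  then have S: "compact S" by (simp add: euclidean_product_topology)
  have coord: "continuous_on UNIV (\<lambda>n :: 'b set \<Rightarrow> real. n A)" for A
    by (rule continuous_on_product_coordinates)
  have Add: "closed Add"
    unfolding Add_def by (intro closed_INT ballI, clarify) (intro closed_Collect_eq continuous_on_add coord)
  have Ext: "closed (Ext B)" for B
    unfolding Ext_def by (intro closed_Collect_eq coord continuous_on_const)
  have "(S \<inter> Add) \<inter> \<Inter>(Ext ` sets \<nu>) \<noteq> {}"
  proof (rule compact_imp_fip)
    show "compact (S \<inter> Add)" using S Add by (rule compact_Int_closed)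
    show "closed T" if "T \<in> Ext ` sets \<nu>" for T using that Ext by auto
    fix F assume "finite F" "F \<subseteq> Ext ` sets \<nu>"
    then obtain \<B> where \<B>: "finite \<B>" "\<B> \<subseteq> sets \<nu>" "F = Ext ` \<B>"
      by (meson finite_subset_image)
    obtain r where r: "\<And>x B. x \<in> space \<nu> \<Longrightarrow> B \<in> \<B> \<Longrightarrow> r x \<in> B \<longleftrightarrow> x \<in> B"
      "\<And>A. r -` A \<inter> space \<nu> \<in> sets \<nu>"
      using finite_representatives[OF \<B>(1,2)] by metis
    define n where "n A = measure \<nu> (r -` A \<inter> space \<nu>)" for A
    have "n \<in> S" by (auto simp: S_def n_def)
    moreover have "n \<in> Add"
      unfolding Add_def
    proof clarsimp
      fix A B :: "'b set" assume "A \<inter> B = {}"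
      then have "measure \<nu> ((r -` A \<inter> space \<nu>) \<union> (r -` B \<inter> space \<nu>)) = n A + n B"
        unfolding n_def using r(2) by (intro finite_measure_Union) auto
      moreover have "(r -` A \<inter> space \<nu>) \<union> (r -` B \<inter> space \<nu>) = r -` (A \<union> B) \<inter> space \<nu>" by auto
      ultimately show "n (A \<union> B) = n A + n B" by (simp add: n_def)
    qed
    moreover have "n \<in> Ext B" if "B \<in> \<B>" for B
    proof -
      have "r -` B \<inter> space \<nu> = B"
        using r(1)[OF _ that] sets.sets_into_space[of B \<nu>] that \<B>(2) by auto
      then show ?thesis by (simp add: Ext_def n_def)
    qed
    ultimately show "(S \<inter> Add) \<inter> \<Inter>F \<noteq> {}" using \<B>(3) by auto
  qed
  then obtain n where n: "n \<in> S" "n \<in> Add" "\<And>B. B \<in> sets \<nu> \<Longrightarrow> n \<in> Ext B" by auto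
  have "finitely_additive n"
    using n(1,2) by (auto simp: finitely_additive_def S_def Add_def PiE_iff)
  then show ?thesis using n(3) by (auto simp: Ext_def)
qed

text \<open>The weighted sum of the point masses at the points \<open>p x\<close> with weights \<open>a x\<close>, described by its lower
  bounds on closed sets; as the weights add up to 1, these determine it.\<close>

lemma ex_regular_finite_support:
  fixes X :: "'a topology" and p :: "'i \<Rightarrow> 'a"
  assumes "compact_space X" "Hausdorff_space X"
    and "finite F" "p \<in> F \<rightarrow> topspace X" "\<And>x. x \<in> F \<Longrightarrow> 0 \<le> a x" "sum a F = 1"
  shows "\<exists>\<mu>. regular_borel_prob X \<mu> \<and>
    (\<forall>K. closedin X K \<longrightarrow> (\<Sum>x | x \<in> F \<and> p x \<in> K. a x) \<le> measure \<mu> K)"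
proof (rule ex_regular_ge_finitely_additive[OF assms(1,2)])
  show "finitely_additive (\<lambda>K. \<Sum>x | x \<in> F \<and> p x \<in> K. a x)"
    unfolding finitely_additive_def
  proof (intro conjI allI impI)
    show "0 \<le> (\<Sum>x | x \<in> F \<and> p x \<in> A. a x)" for A
      using assms(5) by (intro sum_nonneg) auto
    fix A B :: "'a set" assume "A \<inter> B = {}"
    then have "(\<Sum>x\<in>{x \<in> F. p x \<in> A} \<union> {x \<in> F. p x \<in> B}. a x) =
        (\<Sum>x | x \<in> F \<and> p x \<in> A. a x) + (\<Sum>x | x \<in> F \<and> p x \<in> B. a x)"
      using assms(3) by (intro sum.union_disjoint) auto
    moreover have "{x \<in> F. p x \<in> A} \<union> {x \<in> F. p x \<in> B} = {x \<in> F. p x \<in> A \<union> B}" by auto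
    ultimately show "(\<Sum>x | x \<in> F \<and> p x \<in> A \<union> B. a x) =
        (\<Sum>x | x \<in> F \<and> p x \<in> A. a x) + (\<Sum>x | x \<in> F \<and> p x \<in> B. a x)" by simp
  qed
  have "{x \<in> F. p x \<in> topspace X} = F" using assms(4) by auto
  then show "(\<Sum>x | x \<in> F \<and> p x \<in> topspace X. a x) = 1" using assms(6) by simp
qed

section \<open>Lifting measures along a map\<close>

text \<open>Since \<open>f\<close> is a closed map, an open neighbourhood of the preimage of \<open>B\<close> contains the preimage of an
  open neighbourhood of \<open>B\<close>.\<close>

lemma pushforward_regular:
  assumes X: "compact_space X" and Y: "Hausdorff_space Y" and f: "continuous_map X Y f"
    and surj: "f ` topspace X = topspace Y" and \<mu>: "regular_borel_prob X \<mu>"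
  shows "regular_borel_prob Y (pushforward Y f \<mu>)"
proof (rule regular_borel_probI)
  interpret prob_space \<mu> using regular_borel_probD(1)[OF \<mu>] .
  have meas: "f \<in> \<mu> \<rightarrow>\<^sub>M borel_of Y"
    using continuous_map_measurable_borel_of[OF f] regular_borel_probD(3)[OF \<mu>]
    by (simp cong: measurable_cong_sets)
  show "compact_space Y"
    using image_compactin[OF _ f, of "topspace X"] X surj by (simp add: compact_space_def)
  show "space (pushforward Y f \<mu>) = topspace Y" by (simp add: pushforward_def)
  show s: "sets (pushforward Y f \<mu>) = sets (borel_of Y)" by (simp add: pushforward_def)
  show "prob_space (pushforward Y f \<mu>)"
    unfolding pushforward_def using meas by (rule prob_space_distr)
  have push: "measure (pushforward Y f \<mu>) B = measure \<mu> {x \<in> topspace X. f x \<in> B}"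
    if "B \<in> sets (borel_of Y)" for B
    using emeasure_pushforward[OF f \<mu> that] by (simp add: measure_def)
  fix B and e :: real assume B: "B \<in> sets (pushforward Y f \<mu>)" and "0 < e"
  have "{x \<in> topspace X. f x \<in> B} \<in> sets \<mu>"
  proof -
    have "{x \<in> topspace X. f x \<in> B} = f -` B \<inter> space \<mu>"
      using regular_borel_probD(2)[OF \<mu>] by auto
    then show ?thesis using measurable_sets[OF meas] B s by simp
  qed
  from regular_borel_prob_outer[OF \<mu> this \<open>0 < e\<close>] obtain U where
    U: "openin X U" "{x \<in> topspace X. f x \<in> B} \<subseteq> U"
      "measure \<mu> U < measure \<mu> {x \<in> topspace X. f x \<in> B} + e" by auto
  define V where "V = topspace Y - f ` (topspace X - U)"
  have "closed_map X Y f"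
    using continuous_imp_closed_map[OF f X Y] .
  then have V: "openin Y V"
    using U(1) unfolding V_def closed_map_def by (meson closedin_diff closedin_topspace openin_diff openin_topspace)
  have "B \<subseteq> topspace Y" using sets.sets_into_space[OF B] by (simp add: pushforward_def)
  then have BV: "B \<subseteq> V" using U(2) by (auto simp: V_def)
  have "measure (pushforward Y f \<mu>) V = measure \<mu> {x \<in> topspace X. f x \<in> V}"
    using V by (intro push openin_borel_of)
  also have "\<dots> \<le> measure \<mu> U"
    using U(1) by (intro finite_measure_mono) (auto simp: V_def regular_borel_prob_sets[OF \<mu>])
  also have "\<dots> < measure (pushforward Y f \<mu>) B + e"
    using U(3) push B s by simp
  finally show "\<exists>V. openin Y V \<and> B \<subseteq> V \<and>
      measure (pushforward Y f \<mu>) V < measure (pushforward Y f \<mu>) B + e"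
    using V BV by blast
qed

text \<open>The regular measure \<open>\<mu>\<close> that dominates \<open>m\<close> on closed sets has an image dominating \<open>\<nu>\<close> on closed sets,
  so it is at most \<open>\<nu>\<close> on open sets and, by outer regularity of \<open>\<nu>\<close>, on all Borel sets. Two probability
  measures one of which is at most the other coincide.\<close>

lemma ex_lift_of_finitely_additive:
  assumes X: "compact_space X" "Hausdorff_space X"
    and f: "continuous_map X Y f" and \<nu>: "regular_borel_prob Y \<nu>"
    and m: "finitely_additive m"
    and m_\<nu>: "\<And>B. B \<in> sets \<nu> \<Longrightarrow> m {x \<in> topspace X. f x \<in> B} = measure \<nu> B"
  shows "\<exists>\<mu>. regular_borel_prob X \<mu> \<and> pushforward Y f \<mu> = \<nu> \<and>
    (\<forall>K. closedin X K \<longrightarrow> m K \<le> measure \<mu> K)"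
proof -
  interpret \<nu>: prob_space \<nu> using regular_borel_probD(1)[OF \<nu>] .
  have sets_\<nu>: "sets \<nu> = sets (borel_of Y)" and space_\<nu>: "space \<nu> = topspace Y"
    using regular_borel_probD[OF \<nu>] by auto
  have "{x \<in> topspace X. f x \<in> topspace Y} = topspace X"
    using f by (auto simp: continuous_map_def)
  then have "m (topspace X) = 1"
    using m_\<nu>[of "topspace Y"] \<nu>.prob_space by (simp add: space_\<nu> sets_\<nu> openin_borel_of)
  from ex_regular_ge_finitely_additive[OF X m this] obtain \<mu> where
    \<mu>: "regular_borel_prob X \<mu>" and ge: "\<And>K. closedin X K \<Longrightarrow> m K \<le> measure \<mu> K" by auto
  interpret \<mu>: prob_space \<mu> using regular_borel_probD(1)[OF \<mu>] .
  have meas: "f \<in> \<mu> \<rightarrow>\<^sub>M borel_of Y"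
    using continuous_map_measurable_borel_of[OF f] regular_borel_probD(3)[OF \<mu>]
    by (simp cong: measurable_cong_sets)
  let ?\<rho> = "pushforward Y f \<mu>"
  interpret \<rho>: prob_space ?\<rho>
    unfolding pushforward_def using meas by (rule \<mu>.prob_space_distr)
  have sets_\<rho>: "sets ?\<rho> = sets \<nu>" and space_\<rho>: "space ?\<rho> = space \<nu>"
    by (simp_all add: pushforward_def sets_\<nu> space_\<nu>)
  have push: "measure ?\<rho> B = measure \<mu> {x \<in> topspace X. f x \<in> B}" if "B \<in> sets \<nu>" for B
    using emeasure_pushforward[OF f \<mu>] that by (simp add: measure_def sets_\<nu>)
  have open_le: "measure ?\<rho> V \<le> measure \<nu> V" if V: "openin Y V" for V
  proof -
    have Vs: "V \<in> sets \<nu>" using V by (rule regular_borel_prob_sets[OF \<nu>])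
    have C: "closedin Y (topspace Y - V)" using V by auto
    have Cs: "topspace Y - V \<in> sets \<nu>" using C by (rule regular_borel_prob_sets[OF \<nu>])
    have "measure \<nu> (topspace Y - V) = m {x \<in> topspace X. f x \<in> topspace Y - V}"
      using m_\<nu>[OF Cs] by simp
    also have "\<dots> \<le> measure \<mu> {x \<in> topspace X. f x \<in> topspace Y - V}"
      by (rule ge) (rule closedin_continuous_map_preimage[OF f C])
    also have "\<dots> = measure ?\<rho> (topspace Y - V)" using push[OF Cs] by simp
    finally show ?thesis
      using \<nu>.prob_compl[OF Vs] \<rho>.prob_compl[of V] Vs by (simp add: space_\<nu> space_\<rho> sets_\<rho>)
  qed
  have le: "measure ?\<rho> B \<le> measure \<nu> B" if B: "B \<in> sets \<nu>" for B
  proof (rule field_le_epsilon)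
    fix e :: real assume "0 < e"
    from regular_borel_prob_outer[OF \<nu> B this] obtain V where
      V: "openin Y V" "B \<subseteq> V" "measure \<nu> V < measure \<nu> B + e" by auto
    have "measure ?\<rho> B \<le> measure ?\<rho> V"
      using V regular_borel_prob_sets(1)[OF \<nu> V(1)] sets_\<rho> by (intro \<rho>.finite_measure_mono) auto
    with open_le[OF V(1)] V(3) show "measure ?\<rho> B \<le> measure \<nu> B + e" by simp
  qed
  have "?\<rho> = \<nu>"
  proof (rule measure_eqI[OF sets_\<rho>])
    fix B assume "B \<in> sets ?\<rho>"
    then have B: "B \<in> sets \<nu>" by (simp add: sets_\<rho>)
    have "measure ?\<rho> B = measure \<nu> B"
      using le[OF B] le[OF sets.compl_sets[OF B]] \<nu>.prob_compl[OF B] \<rho>.prob_compl[of B] B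
      by (simp add: space_\<rho> sets_\<rho>)
    then show "emeasure ?\<rho> B = emeasure \<nu> B"
      by (simp add: \<rho>.emeasure_eq_measure \<nu>.emeasure_eq_measure)
  qed
  with \<mu> ge show ?thesis by blast
qed

text \<open>Over a point \<open>y\<close> of \<open>V z\<close> the lift places, for each \<open>x\<close> with \<open>\<eta> x = z\<close>, a share of the mass of \<open>y\<close>
  proportional to \<open>a x\<close> at a point of \<open>C x\<close> above \<open>y\<close>; over the remaining points it uses any preimage.
  These choices of preimages need not be measurable, which is why \<open>\<nu>\<close> is first extended to a finitely
  additive function \<open>n\<close> on all subsets of \<open>Y\<close>. For empty \<open>F\<close> the lemma says that every measure lifts.\<close>

lemma ex_lift_with_mass:
  assumes X: "compact_space X" "Hausdorff_space X"
    and f: "continuous_map X Y f" and surj: "f ` topspace X = topspace Y"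
    and \<nu>: "regular_borel_prob Y \<nu>"
    and F: "finite F" and a: "\<And>x. x \<in> F \<Longrightarrow> 0 < (a x :: real)"
    and C: "\<And>x. x \<in> F \<Longrightarrow> closedin X (C x)"
    and V: "\<And>x. x \<in> F \<Longrightarrow> openin Y (V (\<eta> x))" "\<And>x. x \<in> F \<Longrightarrow> V (\<eta> x) \<subseteq> f ` C x"
    and disj: "disjoint_family_on V (\<eta> ` F)"
  shows "\<exists>\<mu>. regular_borel_prob X \<mu> \<and> pushforward Y f \<mu> = \<nu> \<and>
    (\<forall>x\<in>F. a x / (\<Sum>x' | x' \<in> F \<and> \<eta> x' = \<eta> x. a x') * measure \<nu> (V (\<eta> x)) \<le> measure \<mu> (C x))"
proof -
  define c where "c x = a x / (\<Sum>x' | x' \<in> F \<and> \<eta> x' = \<eta> x. a x')" for x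
  have b_pos: "0 < (\<Sum>x' | x' \<in> F \<and> \<eta> x' = \<eta> x. a x')" if "x \<in> F" for x
    using that F a by (intro sum_pos) auto
  have c_nonneg: "0 \<le> c x" if "x \<in> F" for x
    unfolding c_def using that a b_pos by (simp add: less_imp_le)
  have c_sum: "(\<Sum>x | x \<in> F \<and> \<eta> x = z. c x) = 1" if "z \<in> \<eta> ` F" for z
  proof -
    have "(\<Sum>x | x \<in> F \<and> \<eta> x = z. c x) =
        (\<Sum>x | x \<in> F \<and> \<eta> x = z. a x / (\<Sum>x' | x' \<in> F \<and> \<eta> x' = z. a x'))"
      by (rule sum.cong) (auto simp: c_def)
    also have "\<dots> = 1"
      using that b_pos by (force simp: sum_divide_distrib[symmetric])
    finally show ?thesis .
  qed
  obtain n where n: "finitely_additive n" "\<And>B. B \<in> sets \<nu> \<Longrightarrow> n B = measure \<nu> B"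
    using prob_space_finitely_additive_extension[OF regular_borel_probD(1)[OF \<nu>]] by auto
  define s where "s x y = (SOME x'. x' \<in> C x \<and> f x' = y)" for x y
  have s: "s x y \<in> C x \<and> f (s x y) = y" if "x \<in> F" "y \<in> V (\<eta> x)" for x y
    unfolding s_def using V(2)[OF that(1)] that(2)
    by (intro someI_ex[of "\<lambda>x'. x' \<in> C x \<and> f x' = y"]) auto
  define s\<^sub>0 where "s\<^sub>0 y = (SOME x'. x' \<in> topspace X \<and> f x' = y)" for y
  have s\<^sub>0: "s\<^sub>0 y \<in> topspace X \<and> f (s\<^sub>0 y) = y" if "y \<in> topspace Y" for y
    unfolding s\<^sub>0_def using that[folded surj]
    by (intro someI_ex[of "\<lambda>x'. x' \<in> topspace X \<and> f x' = y"]) auto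
  define R where "R = topspace Y - (\<Union>x\<in>F. V (\<eta> x))"
  \<comment> \<open>\<open>m\<close> integrates with respect to \<open>n\<close> the kernel that spreads \<open>y\<close> over its chosen preimages.\<close>
  define m where "m A = (\<Sum>x\<in>F. c x * n {y \<in> V (\<eta> x). s x y \<in> A}) + n {y \<in> R. s\<^sub>0 y \<in> A}" for A
  have CX: "C x \<subseteq> topspace X" if "x \<in> F" for x using C[OF that] by (rule closedin_subset)
  have split: "n {y \<in> P. t y \<in> A \<union> B} = n {y \<in> P. t y \<in> A} + n {y \<in> P. t y \<in> B}"
    if "A \<inter> B = {}" for P A B and t :: "'b \<Rightarrow> 'a"
  proof -
    have "{y \<in> P. t y \<in> A \<union> B} = {y \<in> P. t y \<in> A} \<union> {y \<in> P. t y \<in> B}" by auto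
    then show ?thesis
      using that by (auto intro: finitely_additive_Un_disjoint[OF n(1)])
  qed
  have m: "finitely_additive m"
    unfolding finitely_additive_def
  proof (intro conjI allI impI)
    show "0 \<le> m A" for A
      unfolding m_def using c_nonneg finitely_additive_nonneg[OF n(1)]
      by (intro add_nonneg_nonneg sum_nonneg) auto
    show "m (A \<union> B) = m A + m B" if "A \<inter> B = {}" for A B
      unfolding m_def split[OF that] by (simp add: algebra_simps sum.distrib)
  qed
  have "m {x \<in> topspace X. f x \<in> B} = measure \<nu> B" if B: "B \<in> sets \<nu>" for B
  proof -
    have BY: "B \<subseteq> topspace Y"
      using sets.sets_into_space[OF B] regular_borel_probD(2)[OF \<nu>] by simp
    have "{y \<in> V (\<eta> x). s x y \<in> {x \<in> topspace X. f x \<in> B}} = V (\<eta> x) \<inter> B" if "x \<in> F" for x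
      using s[OF that] CX[OF that] by auto
    moreover have "{y \<in> R. s\<^sub>0 y \<in> {x \<in> topspace X. f x \<in> B}} = R \<inter> B"
      using s\<^sub>0 by (auto simp: R_def)
    ultimately have "m {x \<in> topspace X. f x \<in> B} = (\<Sum>x\<in>F. c x * n (V (\<eta> x) \<inter> B)) + n (R \<inter> B)"
      by (simp add: m_def)
    also have "(\<Sum>x\<in>F. c x * n (V (\<eta> x) \<inter> B)) =
        (\<Sum>z\<in>\<eta> ` F. \<Sum>x | x \<in> F \<and> \<eta> x = z. c x * n (V (\<eta> x) \<inter> B))"
      by (rule sum.image_gen[OF F])
    also have "\<dots> = (\<Sum>z\<in>\<eta> ` F. n (V z \<inter> B))"
    proof (rule sum.cong[OF refl])
      fix z assume "z \<in> \<eta> ` F"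
      have "(\<Sum>x | x \<in> F \<and> \<eta> x = z. c x * n (V (\<eta> x) \<inter> B)) =
          (\<Sum>x | x \<in> F \<and> \<eta> x = z. c x) * n (V z \<inter> B)"
        by (simp add: sum_distrib_right)
      then show "(\<Sum>x | x \<in> F \<and> \<eta> x = z. c x * n (V (\<eta> x) \<inter> B)) = n (V z \<inter> B)"
        by (simp add: c_sum[OF \<open>z \<in> \<eta> ` F\<close>])
    qed
    also have "\<dots> = n (\<Union>z\<in>\<eta> ` F. V z \<inter> B)"
      using F disj by (intro finitely_additive_UN[OF n(1), symmetric])
        (auto simp: disjoint_family_on_def)
    also have "\<dots> + n (R \<inter> B) = n ((\<Union>z\<in>\<eta> ` F. V z \<inter> B) \<union> (R \<inter> B))"
      by (rule finitely_additive_Un_disjoint[OF n(1), symmetric]) (auto simp: R_def)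
    also have "(\<Union>z\<in>\<eta> ` F. V z \<inter> B) \<union> (R \<inter> B) = B" using BY by (auto simp: R_def)
    finally show ?thesis using n(2)[OF B] by simp
  qed
  from ex_lift_of_finitely_additive[OF X f \<nu> m this] obtain \<mu> where
    \<mu>: "regular_borel_prob X \<mu>" "pushforward Y f \<mu> = \<nu>"
    and ge: "\<And>K. closedin X K \<Longrightarrow> m K \<le> measure \<mu> K" by auto
  have "c x * measure \<nu> (V (\<eta> x)) \<le> measure \<mu> (C x)" if x: "x \<in> F" for x
  proof -
    have "{y \<in> V (\<eta> x). s x y \<in> C x} = V (\<eta> x)" using s[OF x] by auto
    then have "c x * measure \<nu> (V (\<eta> x)) = c x * n {y \<in> V (\<eta> x). s x y \<in> C x}"
      using n(2)[OF regular_borel_prob_sets(1)[OF \<nu> V(1)[OF x]]] by simp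
    also have "\<dots> \<le> (\<Sum>x'\<in>F. c x' * n {y \<in> V (\<eta> x'). s x' y \<in> C x})"
      using F x c_nonneg finitely_additive_nonneg[OF n(1)]
      by (intro member_le_sum[of x F "\<lambda>x'. c x' * n {y \<in> V (\<eta> x'). s x' y \<in> C x}"]) auto
    also have "\<dots> \<le> m (C x)" using finitely_additive_nonneg[OF n(1)] by (simp add: m_def)
    also have "\<dots> \<le> measure \<mu> (C x)" using C[OF x] by (rule ge)
    finally show ?thesis .
  qed
  with \<mu> show ?thesis unfolding c_def by blast
qed

section \<open>Weak* neighbourhoods in terms of masses of open sets\<close>

lemma continuous_map_bounded:
  assumes "compact_space X" "continuous_map X euclideanreal \<phi>"
  obtains b where "0 < b" "\<And>x. x \<in> topspace X \<Longrightarrow> \<bar>\<phi> x\<bar> \<le> b"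
proof -
  have "compact (\<phi> ` topspace X)"
    using image_compactin[OF _ assms(2), of "topspace X"] assms(1) by (simp add: compact_space_def)
  then have "bounded (\<phi> ` topspace X)" by (rule compact_imp_bounded)
  then show ?thesis
    using that by (auto simp: bounded_pos)
qed

lemma continuous_map_borel_measurable:
  assumes "regular_borel_prob X \<mu>" "continuous_map X euclideanreal \<phi>"
  shows "\<phi> \<in> borel_measurable \<mu>"
proof (rule borel_measurableI)
  fix S :: "real set" assume "open S"
  then have "openin X {x \<in> topspace X. \<phi> x \<in> S}"
    using assms(2) by (auto simp: continuous_map_def)
  moreover have "\<phi> -` S \<inter> space \<mu> = {x \<in> topspace X. \<phi> x \<in> S}"
    using regular_borel_probD(2)[OF assms(1)] by auto
  ultimately show "\<phi> -` S \<inter> space \<mu> \<in> sets \<mu>"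
    using regular_borel_prob_sets(1)[OF assms(1)] by auto
qed

lemma continuous_map_integrable:
  assumes "compact_space X" "regular_borel_prob X \<mu>" "continuous_map X euclideanreal \<phi>"
  shows "integrable \<mu> \<phi>"
proof -
  interpret prob_space \<mu> using regular_borel_probD(1)[OF assms(2)] .
  obtain b where "\<And>x. x \<in> topspace X \<Longrightarrow> \<bar>\<phi> x\<bar> \<le> b"
    using continuous_map_bounded[OF assms(1,3)] by blast
  then show ?thesis
    using regular_borel_probD(2)[OF assms(2)] continuous_map_borel_measurable[OF assms(2,3)]
    by (intro integrable_const_bound[of _ b]) auto
qed

lemma openin_weak_star_prob_basic:
  assumes "continuous_map X euclideanreal \<phi>" "open V"
  shows "openin (weak_star_prob X) {\<mu>. regular_borel_prob X \<mu> \<and> (\<integral>x. \<phi> x \<partial>\<mu>) \<in> V}"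
  unfolding weak_star_prob_def using assms by (intro topology_generated_by_Basis) blast

text \<open>A common tolerance \<open>e\<close> serves all test functions, because a weak* open set involves only finitely many
  of them around each of its points.\<close>

lemma weak_star_prob_nbhd:
  assumes "openin (weak_star_prob X) W" "\<mu>\<^sub>0 \<in> W"
  shows "\<exists>\<Phi> e. finite \<Phi> \<and> 0 < (e::real) \<and> (\<forall>\<phi>\<in>\<Phi>. continuous_map X euclideanreal \<phi>) \<and>
    (\<forall>\<mu>. regular_borel_prob X \<mu> \<and> (\<forall>\<phi>\<in>\<Phi>. \<bar>(\<integral>x. \<phi> x \<partial>\<mu>) - (\<integral>x. \<phi> x \<partial>\<mu>\<^sub>0)\<bar> < e) \<longrightarrow> \<mu> \<in> W)"
proof -
  from assms(1) have "generate_topology_on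
      {{\<mu>. regular_borel_prob X \<mu> \<and> (\<integral>x. \<phi> x \<partial>\<mu>) \<in> V} | \<phi> V.
        continuous_map X euclideanreal \<phi> \<and> open V} W"
    unfolding weak_star_prob_def by (rule openin_topology_generated_by)
  then show ?thesis using assms(2)
  proof induction
    case Empty
    then show ?case by simp
  next
    case (Int A B)
    then obtain \<Phi> e \<Psi> e' where
      A: "finite \<Phi>" "0 < (e::real)" "\<forall>\<phi>\<in>\<Phi>. continuous_map X euclideanreal \<phi>"
        "\<forall>\<mu>. regular_borel_prob X \<mu> \<and> (\<forall>\<phi>\<in>\<Phi>. \<bar>(\<integral>x. \<phi> x \<partial>\<mu>) - (\<integral>x. \<phi> x \<partial>\<mu>\<^sub>0)\<bar> < e) \<longrightarrow> \<mu> \<in> A" and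
      B: "finite \<Psi>" "0 < (e'::real)" "\<forall>\<phi>\<in>\<Psi>. continuous_map X euclideanreal \<phi>"
        "\<forall>\<mu>. regular_borel_prob X \<mu> \<and> (\<forall>\<phi>\<in>\<Psi>. \<bar>(\<integral>x. \<phi> x \<partial>\<mu>) - (\<integral>x. \<phi> x \<partial>\<mu>\<^sub>0)\<bar> < e') \<longrightarrow> \<mu> \<in> B"
      by auto
    show ?case
      by (rule exI[of _ "\<Phi> \<union> \<Psi>"], rule exI[of _ "min e e'"]) (use A B in auto)
  next
    case (UN K)
    then obtain k where "k \<in> K" "\<mu>\<^sub>0 \<in> k" by auto
    from UN.IH[OF this] obtain \<Phi> e where
      "finite \<Phi>" "0 < (e::real)" "\<forall>\<phi>\<in>\<Phi>. continuous_map X euclideanreal \<phi>"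
      "\<forall>\<mu>. regular_borel_prob X \<mu> \<and> (\<forall>\<phi>\<in>\<Phi>. \<bar>(\<integral>x. \<phi> x \<partial>\<mu>) - (\<integral>x. \<phi> x \<partial>\<mu>\<^sub>0)\<bar> < e) \<longrightarrow> \<mu> \<in> k"
      by auto
    then show ?case
      using \<open>k \<in> K\<close> by (intro exI[of _ \<Phi>] exI[of _ e]) auto
  next
    case (Basis S)
    then obtain \<phi> V where S: "S = {\<mu>. regular_borel_prob X \<mu> \<and> (\<integral>x. \<phi> x \<partial>\<mu>) \<in> V}"
      "continuous_map X euclideanreal \<phi>" "open V" by auto
    with Basis obtain e where "0 < e" "\<And>t. dist t (\<integral>x. \<phi> x \<partial>\<mu>\<^sub>0) < e \<Longrightarrow> t \<in> V"
      using open_dist[of V] by auto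
    then show ?case
      using S by (intro exI[of _ "{\<phi>}"] exI[of _ e]) (auto simp: dist_real_def)
  qed
qed

text \<open>The test function is shifted by its bound \<open>b\<close>, so that it is nonnegative and the part of
  \<open>\<mu>\<close> outside the sets \<open>G x\<close> can be dropped. Applying the resulting lower bound to \<open>- \<phi>\<close> gives the upper
  bound.\<close>

lemma integral_ge_of_masses:
  assumes X: "compact_space X" and \<mu>: "regular_borel_prob X \<mu>"
    and \<phi>: "continuous_map X euclideanreal \<phi>" "\<And>x. x \<in> topspace X \<Longrightarrow> \<bar>\<phi> x\<bar> \<le> b"
    and F: "finite F" "F \<subseteq> topspace X" "sum a F = 1"
    and G: "\<And>x. x \<in> F \<Longrightarrow> openin X (G x)" "disjoint_family_on G F"
    and osc: "\<And>x y. x \<in> F \<Longrightarrow> y \<in> G x \<Longrightarrow> \<bar>\<phi> y - \<phi> x\<bar> \<le> \<eta>" and "0 \<le> \<eta>"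
    and mass: "\<And>x. x \<in> F \<Longrightarrow> a x - \<delta> < measure \<mu> (G x)" and "0 \<le> \<delta>"
  shows "(\<Sum>x\<in>F. a x * \<phi> x) - \<eta> - 2 * b * \<delta> * card F \<le> (\<integral>x. \<phi> x \<partial>\<mu>)"
proof -
  interpret prob_space \<mu> using regular_borel_probD(1)[OF \<mu>] .
  have sp: "space \<mu> = topspace X" using regular_borel_probD(2)[OF \<mu>] .
  have Gs: "G x \<in> sets \<mu>" if "x \<in> F" for x using regular_borel_prob_sets(1)[OF \<mu> G(1)[OF that]] .
  have GX: "G x \<subseteq> topspace X" if "x \<in> F" for x using G(1)[OF that] by (rule openin_subset)
  have int: "integrable \<mu> \<phi>" using continuous_map_integrable[OF X \<mu> \<phi>(1)] .
  have intG: "integrable \<mu> (\<lambda>y. (\<phi> x + b - \<eta>) * indicator (G x) y)" if "x \<in> F" for x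
    using Gs[OF that] by (intro integrable_mult_right integrable_real_indicator) (auto simp: emeasure_eq_measure)
  have "(\<Sum>x\<in>F. measure \<mu> (G x)) = measure \<mu> (\<Union>x\<in>F. G x)"
    using Gs G(2) F by (intro finite_measure_finite_Union[symmetric]) auto
  then have total: "(\<Sum>x\<in>F. measure \<mu> (G x)) \<le> 1" by simp
  have "(\<Sum>x\<in>F. (\<phi> x + b - \<eta>) * indicator (G x) y) \<le> \<phi> y + b" if "y \<in> space \<mu>" for y
  proof (cases "\<exists>x\<in>F. y \<in> G x")
    case True
    then obtain x where x: "x \<in> F" "y \<in> G x" by auto
    have "(\<Sum>x'\<in>F. (\<phi> x' + b - \<eta>) * indicator (G x') y) = (\<Sum>x'\<in>{x}. (\<phi> x' + b - \<eta>) * indicator (G x') y)"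
    proof (rule sum.mono_neutral_right)
      have "y \<notin> G i" if "i \<in> F" "i \<noteq> x" for i
        using disjoint_family_onD[OF G(2) x(1) that(1)] that(2) x(2) by auto
      then show "\<forall>i\<in>F - {x}. (\<phi> i + b - \<eta>) * indicator (G i) y = 0" by simp
    qed (use F x in auto)
    also have "\<dots> \<le> \<phi> y + b" using x osc[OF x] by auto
    finally show ?thesis .
  next
    case False
    then have "(\<Sum>x\<in>F. (\<phi> x + b - \<eta>) * indicator (G x) y) = 0"
      by (intro sum.neutral) auto
    then show ?thesis using \<phi>(2)[of y] that by (auto simp: sp)
  qed
  then have "(\<integral>y. (\<Sum>x\<in>F. (\<phi> x + b - \<eta>) * indicator (G x) y) \<partial>\<mu>) \<le> (\<integral>y. \<phi> y + b \<partial>\<mu>)"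
    using int intG by (intro integral_mono Bochner_Integration.integrable_sum) auto
  also have "\<dots> = (\<integral>y. \<phi> y \<partial>\<mu>) + b" using int by (simp add: prob_space)
  also have "(\<integral>y. (\<Sum>x\<in>F. (\<phi> x + b - \<eta>) * indicator (G x) y) \<partial>\<mu>) = (\<Sum>x\<in>F. (\<phi> x + b - \<eta>) * measure \<mu> (G x))"
    using intG GX by (subst Bochner_Integration.integral_sum) (auto simp: sp Int_absorb2 intro!: sum.cong)
  also have "\<dots> = (\<Sum>x\<in>F. (\<phi> x + b) * measure \<mu> (G x)) - \<eta> * (\<Sum>x\<in>F. measure \<mu> (G x))"
    by (simp add: algebra_simps sum.distrib sum_subtractf sum_distrib_left)
  finally have "(\<Sum>x\<in>F. (\<phi> x + b) * measure \<mu> (G x)) \<le> (\<integral>y. \<phi> y \<partial>\<mu>) + b + \<eta> * (\<Sum>x\<in>F. measure \<mu> (G x))"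
    by simp
  also have "\<dots> \<le> (\<integral>y. \<phi> y \<partial>\<mu>) + b + \<eta>"
    using total \<open>0 \<le> \<eta>\<close> by (simp add: mult_left_le)
  finally have upper: "(\<Sum>x\<in>F. (\<phi> x + b) * measure \<mu> (G x)) \<le> (\<integral>y. \<phi> y \<partial>\<mu>) + b + \<eta>" .
  have "(\<Sum>x\<in>F. a x * (\<phi> x + b) - 2 * b * \<delta>) \<le> (\<Sum>x\<in>F. (\<phi> x + b) * measure \<mu> (G x))"
  proof (rule sum_mono)
    fix x assume x: "x \<in> F"
    then have bd: "0 \<le> \<phi> x + b" "\<phi> x + b \<le> 2 * b" using \<phi>(2)[of x] F by auto
    have "a x * (\<phi> x + b) - 2 * b * \<delta> \<le> a x * (\<phi> x + b) - (\<phi> x + b) * \<delta>"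
      using mult_right_mono[OF bd(2) \<open>0 \<le> \<delta>\<close>] by simp
    also have "\<dots> = (\<phi> x + b) * (a x - \<delta>)" by (simp add: algebra_simps)
    also have "\<dots> \<le> (\<phi> x + b) * measure \<mu> (G x)"
      using mass[OF x] bd by (intro mult_left_mono) auto
    finally show "a x * (\<phi> x + b) - 2 * b * \<delta> \<le> (\<phi> x + b) * measure \<mu> (G x)" .
  qed
  moreover have "(\<Sum>x\<in>F. a x * (\<phi> x + b) - 2 * b * \<delta>) = (\<Sum>x\<in>F. a x * \<phi> x) + b * sum a F - 2 * b * \<delta> * card F"
    by (simp add: algebra_simps sum.distrib sum_subtractf sum_distrib_left)
  ultimately show ?thesis using upper F(3) by simp
qed

lemma integral_near_of_masses:
  assumes X: "compact_space X" and \<mu>: "regular_borel_prob X \<mu>"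
    and \<phi>: "continuous_map X euclideanreal \<phi>" "\<And>x. x \<in> topspace X \<Longrightarrow> \<bar>\<phi> x\<bar> \<le> b"
    and F: "finite F" "F \<subseteq> topspace X" "sum a F = 1"
    and G: "\<And>x. x \<in> F \<Longrightarrow> openin X (G x)" "disjoint_family_on G F"
    and osc: "\<And>x y. x \<in> F \<Longrightarrow> y \<in> G x \<Longrightarrow> \<bar>\<phi> y - \<phi> x\<bar> \<le> \<eta>" and "0 \<le> \<eta>"
    and mass: "\<And>x. x \<in> F \<Longrightarrow> a x - \<delta> < measure \<mu> (G x)" and "0 \<le> \<delta>"
  shows "\<bar>(\<integral>x. \<phi> x \<partial>\<mu>) - (\<Sum>x\<in>F. a x * \<phi> x)\<bar> \<le> \<eta> + 2 * b * \<delta> * card F"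
proof -
  have "(\<Sum>x\<in>F. a x * \<phi> x) - \<eta> - 2 * b * \<delta> * card F \<le> (\<integral>x. \<phi> x \<partial>\<mu>)"
    by (rule integral_ge_of_masses[OF assms])
  moreover have "(\<Sum>x\<in>F. a x * - \<phi> x) - \<eta> - 2 * b * \<delta> * card F \<le> (\<integral>x. - \<phi> x \<partial>\<mu>)"
    using \<phi> osc by (intro integral_ge_of_masses[OF X \<mu> _ _ F G _ \<open>0 \<le> \<eta>\<close> mass \<open>0 \<le> \<delta>\<close>])
      (auto simp: abs_minus_commute intro: continuous_map_minus)
  ultimately show ?thesis by (simp add: sum_negf)
qed

text \<open>Rounding \<open>\<phi> x\<close> up to a multiple \<open>k * \<eta>\<close> gives a sublevel set that contains \<open>x\<close> and hence also
  \<open>r x\<close>; boundedness makes the sublevel sets needed finitely many.\<close>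

lemma finite_range_approximation:
  assumes X: "compact_space X" and \<mu>: "regular_borel_prob X \<mu>"
    and \<Phi>: "finite \<Phi>" "\<And>\<phi>. \<phi> \<in> \<Phi> \<Longrightarrow> continuous_map X euclideanreal \<phi>" and "0 < (\<eta>::real)"
  obtains r where "r \<in> topspace X \<rightarrow> topspace X" "finite (r ` topspace X)"
    "\<And>A. r -` A \<inter> topspace X \<in> sets \<mu>"
    "\<And>\<phi> x. \<phi> \<in> \<Phi> \<Longrightarrow> x \<in> topspace X \<Longrightarrow> \<bar>\<phi> (r x) - \<phi> x\<bar> \<le> \<eta>"
proof -
  have sp: "space \<mu> = topspace X" using regular_borel_probD(2)[OF \<mu>] .
  have "\<forall>\<phi>\<in>\<Phi>. \<exists>b. \<forall>x\<in>topspace X. \<bar>\<phi> x\<bar> \<le> b"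
    using continuous_map_bounded[OF X \<Phi>(2)] by metis
  then obtain b where b: "\<And>\<phi> x. \<phi> \<in> \<Phi> \<Longrightarrow> x \<in> topspace X \<Longrightarrow> \<bar>\<phi> x\<bar> \<le> b \<phi>" by metis
  define L where "L \<phi> k = {x \<in> topspace X. \<phi> x \<le> of_int k * \<eta>}" for \<phi> k
  define K where "K \<phi> = {\<lceil>- b \<phi> / \<eta>\<rceil>..\<lceil>b \<phi> / \<eta>\<rceil>}" for \<phi>
  define \<B> where "\<B> = (\<Union>\<phi>\<in>\<Phi>. L \<phi> ` K \<phi>)"
  have L: "closedin X (L \<phi> k)" if "\<phi> \<in> \<Phi>" for \<phi> k
    using closedin_continuous_map_preimage[OF \<Phi>(2)[OF that], of "{..of_int k * \<eta>}"] by (simp add: L_def)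
  have fin: "finite \<B>" using \<Phi>(1) by (simp add: \<B>_def K_def)
  have "\<B> \<subseteq> sets \<mu>" using regular_borel_prob_sets(2)[OF \<mu> L] by (auto simp: \<B>_def)
  note finite_representatives[OF fin this]
  then obtain r where r: "r \<in> space \<mu> \<rightarrow> space \<mu>" "finite (r ` space \<mu>)"
      "\<And>x B. x \<in> space \<mu> \<Longrightarrow> B \<in> \<B> \<Longrightarrow> r x \<in> B \<longleftrightarrow> x \<in> B" "\<And>A. r -` A \<inter> space \<mu> \<in> sets \<mu>"
    by blast
  have round: "\<phi> y \<le> \<phi> x + \<eta>"
    if "\<phi> \<in> \<Phi>" "x \<in> topspace X" and same: "\<And>B. B \<in> \<B> \<Longrightarrow> x \<in> B \<Longrightarrow> y \<in> B" for \<phi> x y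
  proof -
    let ?k = "\<lceil>\<phi> x / \<eta>\<rceil>"
    have "\<phi> x / \<eta> \<le> of_int ?k" "of_int ?k - 1 < \<phi> x / \<eta>" by linarith+
    then have "\<phi> x \<le> of_int ?k * \<eta>" "(of_int ?k - 1) * \<eta> < \<phi> x"
      unfolding pos_divide_le_eq[OF \<open>0 < \<eta>\<close>] pos_less_divide_eq[OF \<open>0 < \<eta>\<close>] .
    then have k: "\<phi> x \<le> of_int ?k * \<eta>" "of_int ?k * \<eta> < \<phi> x + \<eta>"
      by (simp_all add: left_diff_distrib)
    have "?k \<in> K \<phi>"
      using b[OF that(1,2)] \<open>0 < \<eta>\<close> unfolding K_def atLeastAtMost_iff
      by (intro conjI ceiling_mono divide_right_mono) auto
    then have "L \<phi> ?k \<in> \<B>" using that(1) by (auto simp: \<B>_def)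
    moreover have "x \<in> L \<phi> ?k" using k that(2) by (simp add: L_def)
    ultimately have "y \<in> L \<phi> ?k" by (rule same)
    then show ?thesis using k by (simp add: L_def)
  qed
  show ?thesis
  proof (rule that[of r])
    fix \<phi> x assume \<phi>: "\<phi> \<in> \<Phi>" and x: "x \<in> topspace X"
    then have rx: "r x \<in> topspace X" using r(1) by (auto simp: sp)
    have "\<phi> (r x) \<le> \<phi> x + \<eta>" using r(3) x by (intro round[OF \<phi> x]) (auto simp: sp)
    moreover have "\<phi> x \<le> \<phi> (r x) + \<eta>" using r(3) x by (intro round[OF \<phi> rx]) (auto simp: sp)
    ultimately show "\<bar>\<phi> (r x) - \<phi> x\<bar> \<le> \<eta>" by simp
  qed (use r in \<open>auto simp: sp\<close>)
qed

lemma Hausdorff_disjoint_nbhds: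
  assumes "Hausdorff_space X" "finite F" "F \<subseteq> topspace X"
  obtains G where "\<And>x. x \<in> F \<Longrightarrow> openin X (G x)" "\<And>x. x \<in> F \<Longrightarrow> x \<in> G x" "disjoint_family_on G F"
proof -
  have "\<exists>U V. openin X U \<and> openin X V \<and> x \<in> U \<and> y \<in> V \<and> disjnt U V"
    if "x \<in> F" "y \<in> F" "x \<noteq> y" for x y
    using assms(1,3) that unfolding Hausdorff_space_def by (meson subsetD)
  then obtain U V where UV: "\<And>x y. x \<in> F \<Longrightarrow> y \<in> F \<Longrightarrow> x \<noteq> y \<Longrightarrow>
      openin X (U x y) \<and> openin X (V x y) \<and> x \<in> U x y \<and> y \<in> V x y \<and> disjnt (U x y) (V x y)"
    by metis
  define G where "G x = (\<Inter>y\<in>F - {x}. U x y \<inter> V y x) \<inter> topspace X" for x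
  show ?thesis
  proof (rule that[of G])
    show "openin X (G x)" if "x \<in> F" for x
    proof (cases "F - {x} = {}")
      case False
      then show ?thesis
        unfolding G_def using that assms(2) UV by (intro openin_Int openin_INT2) auto
    next
      case True
      then show ?thesis unfolding G_def by (simp only: INF_empty) simp
    qed
    show "x \<in> G x" if "x \<in> F" for x
      using that assms(3) UV by (auto simp: G_def)
    show "disjoint_family_on G F"
      unfolding disjoint_family_on_def
    proof (intro ballI impI)
      fix x y assume xy: "x \<in> F" "y \<in> F" "x \<noteq> y"
      then have "G x \<subseteq> U x y" "G y \<subseteq> V x y" by (auto simp: G_def)
      then show "G x \<inter> G y = {}" using UV[OF xy] by (auto simp: disjnt_def)
    qed
  qed
qed

text \<open>Weak* neighbourhoods can be described by lower bounds on the masses of finitely many disjoint open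
  sets: \<open>\<mu>\<^sub>0\<close> is approximated by the image under a map \<open>r\<close> of finite range along which the test functions
  hardly change, and a measure with almost the same mass near each point of the range of \<open>r\<close> has almost the
  same integrals. The bounds can be one-sided because the masses of the points add up to 1.\<close>

lemma weak_star_prob_nbhd_masses:
  assumes X: "compact_space X" "Hausdorff_space X"
    and W: "openin (weak_star_prob X) W" "\<mu>\<^sub>0 \<in> W"
  shows "\<exists>F a G \<delta>. finite F \<and> F \<subseteq> topspace X \<and> (\<forall>x\<in>F. 0 < (a x :: real)) \<and> sum a F = 1 \<and>
    (\<forall>x\<in>F. openin X (G x)) \<and> (\<forall>x\<in>F. x \<in> G x) \<and> disjoint_family_on G F \<and> 0 < (\<delta>::real) \<and>
    (\<forall>\<mu>. regular_borel_prob X \<mu> \<longrightarrow> (\<forall>x\<in>F. a x - \<delta> < measure \<mu> (G x)) \<longrightarrow> \<mu> \<in> W)"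
proof -
  have \<mu>\<^sub>0: "regular_borel_prob X \<mu>\<^sub>0" using openin_subset[OF W(1)] W(2) by auto
  interpret prob_space \<mu>\<^sub>0 using regular_borel_probD(1)[OF \<mu>\<^sub>0] .
  have sp: "space \<mu>\<^sub>0 = topspace X" using regular_borel_probD(2)[OF \<mu>\<^sub>0] .
  obtain \<Phi> e where \<Phi>: "finite \<Phi>" "\<And>\<phi>. \<phi> \<in> \<Phi> \<Longrightarrow> continuous_map X euclideanreal \<phi>" and "0 < (e::real)"
    and in_W: "\<And>\<mu>. regular_borel_prob X \<mu> \<Longrightarrow>
      (\<And>\<phi>. \<phi> \<in> \<Phi> \<Longrightarrow> \<bar>(\<integral>x. \<phi> x \<partial>\<mu>) - (\<integral>x. \<phi> x \<partial>\<mu>\<^sub>0)\<bar> < e) \<Longrightarrow> \<mu> \<in> W"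
    using weak_star_prob_nbhd[OF W] by auto
  \<comment> \<open>The integrals differ by at most \<open>3 * \<eta>\<close>: rounding \<open>\<mu>\<^sub>0\<close> to a finite set, oscillation of the test
    functions on the sets \<open>G x\<close>, and the mass outside these sets cost \<open>\<eta>\<close> each.\<close>
  define \<eta> where "\<eta> = e / 4"
  have \<eta>: "0 < \<eta>" using \<open>0 < e\<close> by (simp add: \<eta>_def)
  obtain r where r: "r \<in> topspace X \<rightarrow> topspace X" "finite (r ` topspace X)"
    "\<And>A. r -` A \<inter> topspace X \<in> sets \<mu>\<^sub>0"
    "\<And>\<phi> x. \<phi> \<in> \<Phi> \<Longrightarrow> x \<in> topspace X \<Longrightarrow> \<bar>\<phi> (r x) - \<phi> x\<bar> \<le> \<eta>"
    using finite_range_approximation[OF X(1) \<mu>\<^sub>0 \<Phi> \<eta>] by blast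
  define a where "a x = measure \<mu>\<^sub>0 (r -` {x} \<inter> topspace X)" for x
  define F where "F = {x \<in> r ` topspace X. 0 < a x}"
  have F: "finite F" "F \<subseteq> topspace X" using r(1,2) by (auto simp: F_def)
  have sum_F: "(\<Sum>x\<in>F. a x * t x) = (\<Sum>x\<in>r ` topspace X. a x * t x)" for t
  proof (rule sum.mono_neutral_left[OF r(2)])
    show "F \<subseteq> r ` topspace X" by (auto simp: F_def)
    show "\<forall>x\<in>r ` topspace X - F. a x * t x = 0"
      by (auto simp: F_def a_def zero_less_measure_iff)
  qed
  have int_r: "(\<integral>x. t (r x) \<partial>\<mu>\<^sub>0) = (\<Sum>x\<in>F. a x * t x)" for t :: "'a \<Rightarrow> real"
  proof -
    have "(\<integral>x. t (r x) \<partial>\<mu>\<^sub>0) = (\<integral>x. (\<Sum>y\<in>r ` topspace X. t y * indicator (r -` {y} \<inter> topspace X) x) \<partial>\<mu>\<^sub>0)"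
    proof (rule Bochner_Integration.integral_cong[OF refl])
      fix x assume x: "x \<in> space \<mu>\<^sub>0"
      have "(\<Sum>y\<in>r ` topspace X. t y * indicator (r -` {y} \<inter> topspace X) x) =
          (\<Sum>y\<in>{r x}. t y * indicator (r -` {y} \<inter> topspace X) x)"
        using r(2) x by (intro sum.mono_neutral_right) (auto simp: sp)
      also have "\<dots> = t (r x)" using x by (simp add: sp)
      finally show "t (r x) = (\<Sum>y\<in>r ` topspace X. t y * indicator (r -` {y} \<inter> topspace X) x)" ..
    qed
    also have "\<dots> = (\<Sum>y\<in>r ` topspace X. t y * a y)"
      using r(3) integrable_real_indicator[OF r(3)] by (subst Bochner_Integration.integral_sum) (auto simp: a_def sp Int_assoc emeasure_eq_measure intro!: sum.cong)
    finally show ?thesis by (simp add: sum_F mult.commute)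
  qed
  have a1: "sum a F = 1" using int_r[of "\<lambda>_. 1"] by (simp add: prob_space)
  have near\<^sub>0: "\<bar>(\<integral>x. \<phi> x \<partial>\<mu>\<^sub>0) - (\<Sum>x\<in>F. a x * \<phi> x)\<bar> \<le> \<eta>" if \<phi>: "\<phi> \<in> \<Phi>" for \<phi>
  proof -
    have i1: "integrable \<mu>\<^sub>0 \<phi>" using continuous_map_integrable[OF X(1) \<mu>\<^sub>0 \<Phi>(2)[OF \<phi>]] .
    obtain b where b: "\<And>x. x \<in> topspace X \<Longrightarrow> \<bar>\<phi> x\<bar> \<le> b"
      using continuous_map_bounded[OF X(1) \<Phi>(2)[OF \<phi>]] by blast
    have "(\<lambda>x. \<phi> (r x)) \<in> borel_measurable \<mu>\<^sub>0"
    proof (rule borel_measurableI)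
      fix S :: "real set"
      have "(\<lambda>x. \<phi> (r x)) -` S \<inter> space \<mu>\<^sub>0 = r -` (\<phi> -` S) \<inter> topspace X" by (auto simp: sp)
      then show "(\<lambda>x. \<phi> (r x)) -` S \<inter> space \<mu>\<^sub>0 \<in> sets \<mu>\<^sub>0" using r(3) by simp
    qed
    then have i2: "integrable \<mu>\<^sub>0 (\<lambda>x. \<phi> (r x))"
      using b funcset_mem[OF r(1)] by (intro integrable_const_bound[of _ b] AE_I2) (auto simp: sp)
    have "\<bar>(\<integral>x. \<phi> x \<partial>\<mu>\<^sub>0) - (\<integral>x. \<phi> (r x) \<partial>\<mu>\<^sub>0)\<bar> = \<bar>\<integral>x. \<phi> x - \<phi> (r x) \<partial>\<mu>\<^sub>0\<bar>"
      using i1 i2 by simp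
    also have "\<dots> \<le> (\<integral>x. \<bar>\<phi> x - \<phi> (r x)\<bar> \<partial>\<mu>\<^sub>0)" by (rule integral_abs_bound)
    also have "\<dots> \<le> (\<integral>x. \<eta> \<partial>\<mu>\<^sub>0)"
      using i1 i2 r(4)[OF \<phi>] by (intro integral_mono) (auto simp: sp abs_minus_commute)
    finally show ?thesis by (simp add: int_r prob_space)
  qed
  obtain N where N: "\<And>x. x \<in> F \<Longrightarrow> openin X (N x)" "\<And>x. x \<in> F \<Longrightarrow> x \<in> N x" "disjoint_family_on N F"
    using Hausdorff_disjoint_nbhds[OF X(2) F] by blast
  define G where "G x = N x \<inter> (topspace X \<inter> (\<Inter>\<phi>\<in>\<Phi>. {y \<in> topspace X. \<phi> y \<in> ball (\<phi> x) \<eta>}))" for x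
  have G: "openin X (G x)" "x \<in> G x" if "x \<in> F" for x
  proof -
    show "openin X (G x)"
    proof (cases "\<Phi> = {}")
      case False
      have "openin X {y \<in> topspace X. \<phi> y \<in> ball (\<phi> x) \<eta>}" if "\<phi> \<in> \<Phi>" for \<phi>
        using openin_continuous_map_preimage[OF \<Phi>(2)[OF that], of "ball (\<phi> x) \<eta>"] by simp
      then show ?thesis
        unfolding G_def using N(1)[OF that] \<Phi>(1) False by (intro openin_Int openin_INT2) auto
    qed (use N(1)[OF that] in \<open>auto simp: G_def\<close>)
    show "x \<in> G x" using N(2)[OF that] that F(2) \<eta> by (auto simp: G_def)
  qed
  have disj: "disjoint_family_on G F" using N(3) by (auto simp: disjoint_family_on_def G_def)
  have osc: "\<bar>\<phi> y - \<phi> x\<bar> \<le> \<eta>" if "\<phi> \<in> \<Phi>" "y \<in> G x" for \<phi> x y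
    using that by (auto simp: G_def dist_real_def abs_minus_commute intro: less_imp_le)
  have "\<forall>\<phi>\<in>\<Phi>. \<exists>b>0. \<forall>x\<in>topspace X. \<bar>\<phi> x\<bar> \<le> b"
    using continuous_map_bounded[OF X(1) \<Phi>(2)] by metis
  then obtain b where b: "\<And>\<phi>. \<phi> \<in> \<Phi> \<Longrightarrow> 0 < b \<phi>" "\<And>\<phi> x. \<phi> \<in> \<Phi> \<Longrightarrow> x \<in> topspace X \<Longrightarrow> \<bar>\<phi> x\<bar> \<le> b \<phi>"
    by metis
  \<comment> \<open>\<open>D\<close> bounds, for all test functions at once, the factor that multiplies \<open>\<delta>\<close> in the error of the integral; the summand 1
    keeps it positive.\<close>
  define D where "D = 1 + (\<Sum>\<phi>\<in>\<Phi>. 2 * b \<phi> * card F)"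
  have D: "1 \<le> D" unfolding D_def using b(1) by (auto intro!: sum_nonneg simp: less_imp_le)
  have bD: "2 * b \<phi> * card F \<le> D" if "\<phi> \<in> \<Phi>" for \<phi>
  proof -
    have "2 * b \<phi> * card F \<le> (\<Sum>\<phi>\<in>\<Phi>. 2 * b \<phi> * card F)"
      using that \<Phi>(1) b(1) by (intro member_le_sum[of \<phi> \<Phi> "\<lambda>\<phi>. 2 * b \<phi> * card F"]) (auto simp: less_imp_le)
    then show ?thesis by (simp add: D_def)
  qed
  define \<delta> where "\<delta> = \<eta> / D"
  have \<delta>: "0 < \<delta>" using \<eta> D by (simp add: \<delta>_def)
  show ?thesis
  proof (intro exI conjI ballI allI impI)
    show "0 < a x" if "x \<in> F" for x using that by (simp add: F_def)
    fix \<mu> assume \<mu>: "regular_borel_prob X \<mu>" and "\<forall>x\<in>F. a x - \<delta> < measure \<mu> (G x)"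
    then have mass: "\<And>x. x \<in> F \<Longrightarrow> a x - \<delta> < measure \<mu> (G x)" by blast
    show "\<mu> \<in> W"
    proof (rule in_W[OF \<mu>])
      fix \<phi> assume \<phi>: "\<phi> \<in> \<Phi>"
      have "\<bar>(\<integral>x. \<phi> x \<partial>\<mu>) - (\<Sum>x\<in>F. a x * \<phi> x)\<bar> \<le> \<eta> + 2 * b \<phi> * \<delta> * card F"
        using \<eta> \<delta> by (intro integral_near_of_masses[OF X(1) \<mu> \<Phi>(2)[OF \<phi>] b(2)[OF \<phi>] F a1 G(1) disj
          osc[OF \<phi>] _ mass]) auto
      moreover have "2 * b \<phi> * \<delta> * card F \<le> \<eta>"
      proof -
        have "2 * b \<phi> * \<delta> * card F = (2 * b \<phi> * card F) * \<delta>" by simp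
        also have "\<dots> \<le> D * \<delta>" using bD[OF \<phi>] \<delta> by (intro mult_right_mono) auto
        also have "\<dots> = \<eta>" using D by (simp add: \<delta>_def)
        finally show ?thesis .
      qed
      ultimately show "\<bar>(\<integral>x. \<phi> x \<partial>\<mu>) - (\<integral>x. \<phi> x \<partial>\<mu>\<^sub>0)\<bar> < e"
        using near\<^sub>0[OF \<phi>] \<open>0 < e\<close> unfolding \<eta>_def by linarith
    qed
  qed (use F a1 G disj \<delta> in auto)
qed

section \<open>Semi-open maps\<close>

lemma semi_openD_nonempty_interior:
  assumes "semi_open_map A B g" "openin A U" "U \<noteq> {}"
  shows "B interior_of (g ` U) \<noteq> {}"
  using assms by (auto simp: semi_open_map_def)

text \<open>The subbasic set given by \<open>\<psi>\<close> pulls back to the one given by \<open>\<psi> \<circ> f\<close>.\<close>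

lemma continuous_map_pushforward:
  assumes X: "compact_space X" and Y: "Hausdorff_space Y" and f: "continuous_map X Y f"
    and surj: "f ` topspace X = topspace Y"
  shows "continuous_map (weak_star_prob X) (weak_star_prob Y) (pushforward Y f)"
proof -
  have reg: "regular_borel_prob Y (pushforward Y f \<mu>)" if "regular_borel_prob X \<mu>" for \<mu>
    using pushforward_regular[OF X Y f surj that] .
  have "openin (weak_star_prob X)
      (pushforward Y f -` {\<nu>. regular_borel_prob Y \<nu> \<and> (\<integral>y. \<psi> y \<partial>\<nu>) \<in> V} \<inter> topspace (weak_star_prob X))"
    if \<psi>: "continuous_map Y euclideanreal \<psi>" and V: "open V" for \<psi> V
  proof -
    have "(\<integral>y. \<psi> y \<partial>pushforward Y f \<mu>) = (\<integral>x. (\<psi> \<circ> f) x \<partial>\<mu>)" if \<mu>: "regular_borel_prob X \<mu>" for \<mu>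
    proof -
      have "f \<in> \<mu> \<rightarrow>\<^sub>M borel_of Y"
        using continuous_map_measurable_borel_of[OF f] regular_borel_probD(3)[OF \<mu>]
        by (simp cong: measurable_cong_sets)
      moreover have "\<psi> \<in> borel_measurable (borel_of Y)"
        using continuous_map_borel_measurable[OF reg[OF \<mu>] \<psi>] by (simp add: pushforward_def)
      ultimately show ?thesis by (simp add: pushforward_def integral_distr)
    qed
    then have "pushforward Y f -` {\<nu>. regular_borel_prob Y \<nu> \<and> (\<integral>y. \<psi> y \<partial>\<nu>) \<in> V} \<inter> topspace (weak_star_prob X)
        = {\<mu>. regular_borel_prob X \<mu> \<and> (\<integral>x. (\<psi> \<circ> f) x \<partial>\<mu>) \<in> V}"
      using reg by auto
    then show ?thesis
      using openin_weak_star_prob_basic[OF continuous_map_compose[OF f \<psi>] V] by simp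
  qed
  moreover have "pushforward Y f ` topspace (weak_star_prob X) \<subseteq> topspace (weak_star_prob Y)"
    using reg by auto
  ultimately show ?thesis
    unfolding weak_star_prob_def[of Y] continuous_on_generated_topo_iff topology_generated_by_topspace
    by blast
qed

lemma pushforward_surj:
  assumes X: "compact_space X" "Hausdorff_space X" and Y: "Hausdorff_space Y"
    and f: "continuous_map X Y f" and surj: "f ` topspace X = topspace Y"
  shows "pushforward Y f ` topspace (weak_star_prob X) = topspace (weak_star_prob Y)"
proof
  show "pushforward Y f ` topspace (weak_star_prob X) \<subseteq> topspace (weak_star_prob Y)"
    using pushforward_regular[OF X(1) Y f surj] by auto
  show "topspace (weak_star_prob Y) \<subseteq> pushforward Y f ` topspace (weak_star_prob X)"
  proof
    fix \<nu> assume "\<nu> \<in> topspace (weak_star_prob Y)"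
    then have "regular_borel_prob Y \<nu>" by simp
    then have "\<exists>\<mu>. regular_borel_prob X \<mu> \<and> pushforward Y f \<mu> = \<nu>"
      using ex_lift_with_mass[OF X f surj, of \<nu> "{}"] by (auto simp: disjoint_family_on_def)
    then show "\<nu> \<in> pushforward Y f ` topspace (weak_star_prob X)" by force
  qed
qed

lemma ex_bump_function:
  assumes X: "compact_space X" "Hausdorff_space X" and U: "openin X U" "x \<in> U"
  obtains \<psi> where "continuous_map X euclideanreal \<psi>" "\<And>y. y \<in> topspace X \<Longrightarrow> 0 \<le> \<psi> y \<and> \<psi> y \<le> 1"
    "\<psi> x = 1" "\<And>y. y \<in> topspace X - U \<Longrightarrow> \<psi> y = 0"
proof -
  have x: "x \<in> topspace X" using openin_subset[OF U(1)] U(2) by auto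
  have "normal_space X" using X by (simp add: compact_Hausdorff_or_regular_imp_normal_space)
  moreover have "closedin X (topspace X - U)" using U by auto
  moreover have "closedin X {x}" using X x by (simp add: closedin_Hausdorff_singleton)
  moreover have "disjnt (topspace X - U) {x}" using U by auto
  ultimately obtain \<psi> where "continuous_map X (top_of_set {0..1::real}) \<psi>"
    "\<psi> ` (topspace X - U) \<subseteq> {0}" "\<psi> ` {x} \<subseteq> {1}"
    using Urysohn_lemma[of X "topspace X - U" "{x}" 0 1] by auto
  then show ?thesis
    by (intro that[of \<psi>]) (auto simp: continuous_map_in_subtopology)
qed

lemma integral_bump_bounds:
  assumes X: "compact_space X" and \<mu>: "regular_borel_prob X \<mu>"
    and \<psi>: "continuous_map X euclideanreal \<psi>" "\<And>y. y \<in> topspace X \<Longrightarrow> 0 \<le> \<psi> y \<and> \<psi> y \<le> 1"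
  shows "B \<in> sets \<mu> \<Longrightarrow> (\<And>y. y \<in> topspace X - B \<Longrightarrow> \<psi> y = 0) \<Longrightarrow> (\<integral>y. \<psi> y \<partial>\<mu>) \<le> measure \<mu> B"
    and "B \<in> sets \<mu> \<Longrightarrow> (\<And>y. y \<in> B \<Longrightarrow> \<psi> y = 1) \<Longrightarrow> measure \<mu> B \<le> (\<integral>y. \<psi> y \<partial>\<mu>)"
proof -
  interpret prob_space \<mu> using regular_borel_probD(1)[OF \<mu>] .
  have sp: "space \<mu> = topspace X" using regular_borel_probD(2)[OF \<mu>] .
  have int: "integrable \<mu> \<psi>" using continuous_map_integrable[OF X \<mu> \<psi>(1)] .
  assume B: "B \<in> sets \<mu>"
  then have intB: "integrable \<mu> (indicator B :: _ \<Rightarrow> real)"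
    by (intro integrable_real_indicator) (auto simp: emeasure_eq_measure)
  have BX: "B \<inter> space \<mu> = B" using sets.sets_into_space[OF B] by auto
  show "(\<integral>y. \<psi> y \<partial>\<mu>) \<le> measure \<mu> B" if "\<And>y. y \<in> topspace X - B \<Longrightarrow> \<psi> y = 0"
  proof -
    have "(\<integral>y. \<psi> y \<partial>\<mu>) \<le> (\<integral>y. indicator B y \<partial>\<mu>)"
      using \<psi>(2) that by (intro integral_mono int intB) (auto simp: sp split: split_indicator)
    then show ?thesis by (simp add: BX)
  qed
  show "measure \<mu> B \<le> (\<integral>y. \<psi> y \<partial>\<mu>)" if "\<And>y. y \<in> B \<Longrightarrow> \<psi> y = 1"
  proof -
    have "(\<integral>y. indicator B y \<partial>\<mu>) \<le> (\<integral>y. \<psi> y \<partial>\<mu>)"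
      using \<psi>(2) that by (intro integral_mono int intB) (auto simp: sp split: split_indicator)
    then show ?thesis by (simp add: BX)
  qed
qed

lemma closed_nbhd:
  assumes "compact_space X" "Hausdorff_space X" "openin X G" "x \<in> G"
  obtains U C where "openin X U" "closedin X C" "x \<in> U" "U \<subseteq> C" "C \<subseteq> G"
proof -
  have "neighbourhood_base_of (closedin X) X"
    using compact_Hausdorff_imp_regular_space[OF assms(1,2)] by (simp add: neighbourhood_base_of_closedin)
  then have "\<exists>U C. openin X U \<and> closedin X C \<and> x \<in> U \<and> U \<subseteq> C \<and> C \<subseteq> G"
    using assms(3,4) by (simp add: neighbourhood_base_of)
  with that show ?thesis by blast
qed

text \<open>Around a measure of an open set \<open>W\<close> there are points \<open>x\<close> with weights \<open>a x\<close> such that almost having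
  mass \<open>a x\<close> near each \<open>x\<close> puts a measure into \<open>W\<close>. Semi-openness provides points \<open>\<eta> x\<close> interior to
  the images of closed neighbourhoods \<open>C x\<close>. The points \<open>\<eta> x\<close> can coincide, as when \<open>Y\<close> has isolated
  points, so the weights are collected into \<open>b z\<close> for each value \<open>z\<close>. A measure on \<open>Y\<close> with almost mass
  \<open>b z\<close> on small disjoint neighbourhoods \<open>V z\<close> of the values lifts to a measure that splits the mass of
  \<open>V z\<close> among the sets \<open>C x\<close> in the ratio of the weights, and such measures form an open set.\<close>

lemma semi_open_map_pushforward:
  assumes X: "compact_space X" "Hausdorff_space X" and Y: "Hausdorff_space Y"
    and f: "semi_open_map X Y f"
  shows "semi_open_map (weak_star_prob X) (weak_star_prob Y) (pushforward Y f)"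
proof -
  have cont: "continuous_map X Y f" and surj: "f ` topspace X = topspace Y"
    using f by (auto simp: semi_open_map_def)
  have cY: "compact_space Y"
    using image_compactin[OF _ cont, of "topspace X"] X surj by (simp add: compact_space_def)
  have "weak_star_prob Y interior_of (pushforward Y f ` W) \<noteq> {}"
    if W: "openin (weak_star_prob X) W" "W \<noteq> {}" for W
  proof -
    obtain \<mu>\<^sub>0 where "\<mu>\<^sub>0 \<in> W" using W by auto
    obtain F a G \<delta> where F: "finite F" "F \<subseteq> topspace X"
      and a[rule_format]: "\<forall>x\<in>F. 0 < (a x :: real)" "sum a F = 1"
      and G[rule_format]: "\<forall>x\<in>F. openin X (G x)" "\<forall>x\<in>F. x \<in> G x" "disjoint_family_on G F"
      and \<delta>: "0 < (\<delta>::real)"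
      and in_W[rule_format]: "\<forall>\<mu>. regular_borel_prob X \<mu> \<longrightarrow>
        (\<forall>x\<in>F. a x - \<delta> < measure \<mu> (G x)) \<longrightarrow> \<mu> \<in> W"
      using weak_star_prob_nbhd_masses[OF X W(1) \<open>\<mu>\<^sub>0 \<in> W\<close>] by blast
    have "\<exists>U C. openin X U \<and> closedin X C \<and> x \<in> U \<and> U \<subseteq> C \<and> C \<subseteq> G x" if "x \<in> F" for x
      by (rule closed_nbhd[OF X G(1,2)[OF that]]) blast
    then obtain U C where UC: "\<And>x. x \<in> F \<Longrightarrow> openin X (U x)" "\<And>x. x \<in> F \<Longrightarrow> closedin X (C x)"
      "\<And>x. x \<in> F \<Longrightarrow> x \<in> U x" "\<And>x. x \<in> F \<Longrightarrow> U x \<subseteq> C x" "\<And>x. x \<in> F \<Longrightarrow> C x \<subseteq> G x"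
      by metis
    define I where "I x = Y interior_of (f ` U x)" for x
    have "\<exists>y. y \<in> I x" if "x \<in> F" for x
      using semi_openD_nonempty_interior[OF f UC(1)[OF that]] UC(3)[OF that] by (auto simp: I_def)
    then obtain \<eta> where \<eta>: "\<And>x. x \<in> F \<Longrightarrow> \<eta> x \<in> I x" by metis
    have I: "openin Y (I x)" "I x \<subseteq> f ` U x" for x
      by (auto simp: I_def interior_of_subset)
    have Z: "finite (\<eta> ` F)" "\<eta> ` F \<subseteq> topspace Y"
      using F \<eta> openin_subset[OF I(1)] by auto
    obtain N where N: "\<And>z. z \<in> \<eta> ` F \<Longrightarrow> openin Y (N z)" "\<And>z. z \<in> \<eta> ` F \<Longrightarrow> z \<in> N z"
      "disjoint_family_on N (\<eta> ` F)"
      using Hausdorff_disjoint_nbhds[OF Y Z] by metis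
    define V where "V z = N z \<inter> (\<Inter>x\<in>{x \<in> F. \<eta> x = z}. I x)" for z
    have V: "openin Y (V z)" "z \<in> V z" if "z \<in> \<eta> ` F" for z
    proof -
      show "openin Y (V z)"
        unfolding V_def using that F N(1)[OF that] I(1) by (intro openin_Int openin_INT2) auto
      show "z \<in> V z" using N(2)[OF that] \<eta> by (auto simp: V_def)
    qed
    have V_open: "openin Y (V (\<eta> x))" if "x \<in> F" for x
      using that by (intro V(1)) simp
    have V_sub: "V (\<eta> x) \<subseteq> f ` C x" if "x \<in> F" for x
    proof -
      have "V (\<eta> x) \<subseteq> I x" using that by (auto simp: V_def)
      with I(2)[of x] UC(4)[OF that] show ?thesis by blast
    qed
    have disj: "disjoint_family_on V (\<eta> ` F)"
      using N(3) by (auto simp: disjoint_family_on_def V_def)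
    define b where "b z = (\<Sum>x | x \<in> F \<and> \<eta> x = z. a x)" for z
    have "\<exists>\<psi>. continuous_map Y euclideanreal \<psi> \<and> (\<forall>y\<in>topspace Y. 0 \<le> \<psi> y \<and> \<psi> y \<le> 1) \<and>
        \<psi> z = 1 \<and> (\<forall>y\<in>topspace Y - V z. \<psi> y = 0)" if "z \<in> \<eta> ` F" for z
      by (rule ex_bump_function[OF cY Y V[OF that]]) blast
    then obtain \<psi> where \<psi>: "\<And>z. z \<in> \<eta> ` F \<Longrightarrow> continuous_map Y euclideanreal (\<psi> z)"
      "\<And>z y. z \<in> \<eta> ` F \<Longrightarrow> y \<in> topspace Y \<Longrightarrow> 0 \<le> \<psi> z y \<and> \<psi> z y \<le> 1"
      "\<And>z. z \<in> \<eta> ` F \<Longrightarrow> \<psi> z z = 1"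
      "\<And>z y. z \<in> \<eta> ` F \<Longrightarrow> y \<in> topspace Y - V z \<Longrightarrow> \<psi> z y = 0"
      by metis
    define Q where "Q = (\<Inter>z\<in>\<eta> ` F. {\<nu>. regular_borel_prob Y \<nu> \<and> (\<integral>y. \<psi> z y \<partial>\<nu>) \<in> {b z - \<delta><..}})"
    have "F \<noteq> {}" using a(2) by auto
    then have "openin (weak_star_prob Y) Q"
      unfolding Q_def using Z(1) \<psi>(1)
      by (intro openin_INT2 openin_weak_star_prob_basic) auto
    moreover have "Q \<subseteq> pushforward Y f ` W"
    proof
      fix \<nu> assume Q: "\<nu> \<in> Q"
      then have \<nu>: "regular_borel_prob Y \<nu>" using \<open>F \<noteq> {}\<close> by (auto simp: Q_def)
      obtain \<mu> where \<mu>: "regular_borel_prob X \<mu>" "pushforward Y f \<mu> = \<nu>"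
        and mass: "\<And>x. x \<in> F \<Longrightarrow> a x / b (\<eta> x) * measure \<nu> (V (\<eta> x)) \<le> measure \<mu> (C x)"
        using ex_lift_with_mass[where V = V and a = a and C = C and \<eta> = \<eta>,
          OF X cont surj \<nu> F(1) a(1) UC(2) V_open V_sub disj]
        unfolding b_def by blast
      have "a x - \<delta> < measure \<mu> (G x)" if x: "x \<in> F" for x
      proof -
        interpret \<mu>: prob_space \<mu> using regular_borel_probD(1)[OF \<mu>(1)] .
        have "b (\<eta> x) - \<delta> < (\<integral>y. \<psi> (\<eta> x) y \<partial>\<nu>)" using Q x by (auto simp: Q_def)
        also have "\<dots> \<le> measure \<nu> (V (\<eta> x))"
          using x \<psi> V by (intro integral_bump_bounds(1)[OF cY \<nu>] regular_borel_prob_sets(1)[OF \<nu>]) auto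
        finally have \<nu>V: "b (\<eta> x) - \<delta> < measure \<nu> (V (\<eta> x))" .
        have ab: "a x \<le> b (\<eta> x)"
          unfolding b_def using x F a(1)
          by (intro member_le_sum[of x "{x' \<in> F. \<eta> x' = \<eta> x}" a]) (auto intro: less_imp_le)
        have b0: "0 < b (\<eta> x)" using ab a(1)[OF x] by simp
        \<comment> \<open>Of the defect \<open>\<delta>\<close> of \<open>V (\<eta> x)\<close>, \<open>x\<close> bears only its share.\<close>
        have "a x - \<delta> \<le> a x - a x / b (\<eta> x) * \<delta>"
          using mult_right_mono[of "a x / b (\<eta> x)" 1 \<delta>] ab b0 \<delta> by simp
        also have "\<dots> = a x / b (\<eta> x) * (b (\<eta> x) - \<delta>)" using b0 by (simp add: field_simps)
        also have "\<dots> < a x / b (\<eta> x) * measure \<nu> (V (\<eta> x))"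
          using \<nu>V b0 a(1)[OF x] by (intro mult_strict_left_mono) auto
        also have "\<dots> \<le> measure \<mu> (C x)" by (rule mass[OF x])
        also have "\<dots> \<le> measure \<mu> (G x)"
          using UC(5)[OF x] G(1)[OF x] by (intro \<mu>.finite_measure_mono regular_borel_prob_sets(1)[OF \<mu>(1)]) auto
        finally show ?thesis .
      qed
      then have "\<mu> \<in> W" by (rule in_W[OF \<mu>(1)])
      then show "\<nu> \<in> pushforward Y f ` W" using \<mu>(2) by blast
    qed
    moreover have "Q \<noteq> {}"
    proof -
      have "\<eta> \<in> F \<rightarrow> topspace Y" using Z(2) by auto
      from ex_regular_finite_support[OF cY Y F(1) this less_imp_le[OF a(1)] a(2)] obtain \<nu> where
        \<nu>: "regular_borel_prob Y \<nu>"
        and ge: "\<And>K. closedin Y K \<Longrightarrow> (\<Sum>x | x \<in> F \<and> \<eta> x \<in> K. a x) \<le> measure \<nu> K" by blast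
      have "b z - \<delta> < (\<integral>y. \<psi> z y \<partial>\<nu>)" if z: "z \<in> \<eta> ` F" for z
      proof -
        have zc: "closedin Y {z}" using z Z(2) Y by (auto simp: closedin_Hausdorff_singleton)
        have "b z - \<delta> < b z" using \<delta> by simp
        also have "\<dots> \<le> measure \<nu> {z}" using ge[OF zc] by (simp add: b_def)
        also have "\<dots> \<le> (\<integral>y. \<psi> z y \<partial>\<nu>)"
          using z \<psi> zc by (intro integral_bump_bounds(2)[OF cY \<nu>] regular_borel_prob_sets(2)[OF \<nu>]) auto
        finally show ?thesis .
      qed
      then have "\<nu> \<in> Q" using \<nu> by (auto simp: Q_def)
      then show ?thesis by auto
    qed
    ultimately show ?thesis using interior_of_maximal by (metis subset_empty)
  qed
  then show ?thesis
    using continuous_map_pushforward[OF X(1) Y cont surj] pushforward_surj[OF X Y cont surj]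
    by (auto simp: semi_open_map_def)
qed

text \<open>If \<open>f ` U\<close> had empty interior, then for a closed neighbourhood \<open>C \<subseteq> U\<close> of a point the closed set \<open>f ` C\<close> would have dense
  complement, and measures supported by finitely many points of that complement would be dense. However,
  the measures charging \<open>C\<close> include a nonempty open set, and the image of such a measure charges \<open>f ` C\<close>.\<close>

lemma semi_open_map_if_pushforward:
  assumes X: "compact_space X" "Hausdorff_space X" and Y: "Hausdorff_space Y"
    and cont: "continuous_map X Y f" and surj: "f ` topspace X = topspace Y"
    and push: "semi_open_map (weak_star_prob X) (weak_star_prob Y) (pushforward Y f)"
  shows "semi_open_map X Y f"
proof -
  have cY: "compact_space Y"
    using image_compactin[OF _ cont, of "topspace X"] X surj by (simp add: compact_space_def)
  have "Y interior_of (f ` U) \<noteq> {}" if U: "openin X U" "U \<noteq> {}" for U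
  proof
    assume empty: "Y interior_of (f ` U) = {}"
    obtain x where "x \<in> U" using U by auto
    then have x: "x \<in> topspace X" using openin_subset[OF U(1)] by auto
    obtain U' C where C: "openin X U'" "closedin X C" "x \<in> U'" "U' \<subseteq> C" "C \<subseteq> U"
      using closed_nbhd[OF X U(1) \<open>x \<in> U\<close>] by blast
    have "closed_map X Y f" using continuous_imp_closed_map[OF cont X(1) Y] .
    then have fC: "closedin Y (f ` C)" using C(2) by (simp add: closed_map_def)
    obtain \<psi> where \<psi>: "continuous_map X euclideanreal \<psi>" "\<And>y. y \<in> topspace X \<Longrightarrow> 0 \<le> \<psi> y \<and> \<psi> y \<le> 1"
      "\<psi> x = 1" "\<And>y. y \<in> topspace X - U' \<Longrightarrow> \<psi> y = 0"
      using ex_bump_function[OF X C(1,3)] by blast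
    define W where "W = {\<mu>. regular_borel_prob X \<mu> \<and> (\<integral>y. \<psi> y \<partial>\<mu>) \<in> {0<..}}"
    have W: "openin (weak_star_prob X) W"
      unfolding W_def using \<psi>(1) by (intro openin_weak_star_prob_basic) auto
    have "W \<noteq> {}"
    proof -
      obtain \<mu> where \<mu>: "regular_borel_prob X \<mu>"
        and ge: "\<And>K. closedin X K \<Longrightarrow> (\<Sum>y | y \<in> {x} \<and> y \<in> K. 1) \<le> measure \<mu> K"
        using ex_regular_finite_support[OF X, of "{x}" "\<lambda>y. y" "\<lambda>_. 1"] x by auto
      have xc: "closedin X {x}" using x X by (simp add: closedin_Hausdorff_singleton)
      have "{y. y \<in> {x} \<and> y \<in> {x}} = {x}" by auto
      then have "1 \<le> measure \<mu> {x}" using ge[OF xc] by simp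
      also have "\<dots> \<le> (\<integral>y. \<psi> y \<partial>\<mu>)"
        using \<psi> xc by (intro integral_bump_bounds(2)[OF X(1) \<mu>] regular_borel_prob_sets(2)[OF \<mu>]) auto
      finally have "\<mu> \<in> W" using \<mu> by (simp add: W_def)
      then show ?thesis by auto
    qed
    then obtain \<nu>\<^sub>0 where \<nu>\<^sub>0: "\<nu>\<^sub>0 \<in> weak_star_prob Y interior_of (pushforward Y f ` W)"
      using semi_openD_nonempty_interior[OF push W] by auto
    obtain F a G \<delta> where F: "finite F" "F \<subseteq> topspace Y" and a[rule_format]: "\<forall>y\<in>F. 0 < (a y :: real)" "sum a F = 1"
      and G[rule_format]: "\<forall>y\<in>F. openin Y (G y)" "\<forall>y\<in>F. y \<in> G y" "disjoint_family_on G F"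
      and \<delta>: "0 < (\<delta>::real)"
      and in_int[rule_format]: "\<forall>\<nu>. regular_borel_prob Y \<nu> \<longrightarrow>
        (\<forall>y\<in>F. a y - \<delta> < measure \<nu> (G y)) \<longrightarrow> \<nu> \<in> weak_star_prob Y interior_of (pushforward Y f ` W)"
      using weak_star_prob_nbhd_masses[OF cY Y openin_interior_of \<nu>\<^sub>0] by blast
    \<comment> \<open>Moving the support of the approximating measure off \<open>f ` C\<close> keeps it in the given open set.\<close>
    have "\<exists>p. p \<in> G y - f ` C" if "y \<in> F" for y
    proof (rule ccontr)
      assume "\<not> ?thesis"
      then have "G y \<subseteq> f ` U" using C(5) by auto
      then have "G y \<subseteq> Y interior_of (f ` U)" using G(1)[OF that] by (rule interior_of_maximal)
      then show False using empty G(2)[OF that] by auto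
    qed
    then obtain p where p: "\<And>y. y \<in> F \<Longrightarrow> p y \<in> G y" "\<And>y. y \<in> F \<Longrightarrow> p y \<notin> f ` C"
      by (metis DiffE)
    have pY: "p y \<in> topspace Y" if "y \<in> F" for y
      using p(1)[OF that] openin_subset[OF G(1)[OF that]] by auto
    then have "p \<in> F \<rightarrow> topspace Y" by auto
    from ex_regular_finite_support[OF cY Y F(1) this less_imp_le[OF a(1)] a(2)] obtain \<nu> where
      \<nu>: "regular_borel_prob Y \<nu>"
      and ge: "\<And>K. closedin Y K \<Longrightarrow> (\<Sum>y | y \<in> F \<and> p y \<in> K. a y) \<le> measure \<nu> K" by blast
    interpret \<nu>: prob_space \<nu> using regular_borel_probD(1)[OF \<nu>] .
    have "a y - \<delta> < measure \<nu> (G y)" if y: "y \<in> F" for y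
    proof -
      have pc: "closedin Y {p y}" using pY[OF y] Y by (simp add: closedin_Hausdorff_singleton)
      have "a y \<le> (\<Sum>y' | y' \<in> F \<and> p y' \<in> {p y}. a y')"
        using y F a(1) by (intro member_le_sum) (auto intro: less_imp_le)
      also have "\<dots> \<le> measure \<nu> {p y}" by (rule ge[OF pc])
      also have "\<dots> \<le> measure \<nu> (G y)"
        using p(1)[OF y] G(1)[OF y] by (intro \<nu>.finite_measure_mono regular_borel_prob_sets(1)[OF \<nu>]) auto
      finally show ?thesis using \<delta> by simp
    qed
    then have "\<nu> \<in> weak_star_prob Y interior_of (pushforward Y f ` W)" by (rule in_int[OF \<nu>])
    then have "\<nu> \<in> pushforward Y f ` W" by (rule subsetD[OF interior_of_subset])
    then obtain \<mu> where \<mu>: "regular_borel_prob X \<mu>" "0 < (\<integral>y. \<psi> y \<partial>\<mu>)" "pushforward Y f \<mu> = \<nu>"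
      by (auto simp: W_def)
    interpret \<mu>: prob_space \<mu> using regular_borel_probD(1)[OF \<mu>(1)] .
    have pcl: "closedin Y (p ` F)"
      using F(1) pY by (intro compactin_imp_closedin[OF Y] finite_imp_compactin) auto
    have "1 = sum a F" using a(2) ..
    also have "sum a F = (\<Sum>y | y \<in> F \<and> p y \<in> p ` F. a y)" by (rule sum.cong) auto
    also have "\<dots> \<le> measure \<nu> (p ` F)" by (rule ge[OF pcl])
    finally have "1 \<le> measure \<nu> (p ` F)" .
    moreover have "measure \<nu> (f ` C \<union> p ` F) = measure \<nu> (f ` C) + measure \<nu> (p ` F)"
    proof (intro \<nu>.finite_measure_Union regular_borel_prob_sets(2)[OF \<nu>] fC pcl)
      show "f ` C \<inter> p ` F = {}"
      proof (rule equals0I)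
        fix q assume q: "q \<in> f ` C \<inter> p ` F"
        then obtain y where "y \<in> F" "q = p y" by (elim IntE imageE) simp
        then show False using q p(2)[of y] by simp
      qed
    qed
    ultimately have "measure \<nu> (f ` C) \<le> 0"
      using \<nu>.prob_le_1[of "f ` C \<union> p ` F"] by linarith
    moreover have "measure \<nu> (f ` C) = measure \<mu> {x \<in> topspace X. f x \<in> f ` C}"
      using emeasure_pushforward[OF cont \<mu>(1) closedin_borel_of[OF fC]]
      unfolding \<mu>(3) measure_def by simp
    moreover have "measure \<mu> C \<le> measure \<mu> {x \<in> topspace X. f x \<in> f ` C}"
      using closedin_subset[OF C(2)] closedin_continuous_map_preimage[OF cont fC]
      by (intro \<mu>.finite_measure_mono regular_borel_prob_sets(2)[OF \<mu>(1)]) auto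
    moreover have "(\<integral>y. \<psi> y \<partial>\<mu>) \<le> measure \<mu> C"
      using \<psi> C by (intro integral_bump_bounds(1)[OF X(1) \<mu>(1)] regular_borel_prob_sets(2)[OF \<mu>(1)]) auto
    ultimately show False using \<mu>(2) by simp
  qed
  with cont surj show ?thesis unfolding semi_open_map_def by blast
qed

theorem theorem1p2p5:
  fixes X :: "'a topology" and Y :: "'b set" and d :: "'b \<Rightarrow> 'b \<Rightarrow> real" and f :: "'a \<Rightarrow> 'b"
  assumes "compact_space X" and "Hausdorff_space X"
    and "Metric_space Y d"
    and "continuous_map X (Metric_space.mtopology Y d) f"
    and "f ` topspace X = Y"
  shows "semi_open_map X (Metric_space.mtopology Y d) f \<longleftrightarrow>
    semi_open_map (weak_star_prob X) (weak_star_prob (Metric_space.mtopology Y d))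
      (pushforward (Metric_space.mtopology Y d) f)"
proof -
  interpret Metric_space Y d by fact
  have surj: "f ` topspace X = topspace mtopology" using assms(5) by simp
  show ?thesis
  proof
    assume "semi_open_map X mtopology f"
    then show "semi_open_map (weak_star_prob X) (weak_star_prob mtopology) (pushforward mtopology f)"
      by (rule semi_open_map_pushforward[OF assms(1,2) Hausdorff_space_mtopology])
  next
    assume "semi_open_map (weak_star_prob X) (weak_star_prob mtopology) (pushforward mtopology f)"
    then show "semi_open_map X mtopology f"
      by (rule semi_open_map_if_pushforward[OF assms(1,2) Hausdorff_space_mtopology assms(4) surj])
  qed
qed

end
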